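(* In the setting described in the context, assume there exists $\bar Z\in\mathbb{R}^{(n+m)\times n}$ with $\begin{bmatrix} I\\ \bar Z\end{bmatrix}^\top N\begin{bmatrix} I\\ \bar Z\end{bmatrix}>0$. Then the data $(U_-,X)$ are informative for quadratic stabilization if and only if there exist a symmetric $P\in\mathbb{R}^{n\times n}$ with $P>0$, a matrix $L\in\mathbb{R}^{m\times n}$ and scalars $\alpha\ge0$, $\beta>0$ such that $$\begin{bmatrix} P-\beta I & 0 & 0 & 0\\ 0 & -P & -L^\top & 0\\ 0 & -L & 0 & L\\ 0 & 0 & L^\top & P\end{bmatrix}-\alpha\begin{bmatrix} I & X_+\\ 0 & -X_-\\ 0 & -U_-\\ 0 & 0\end{bmatrix}\begin{bmatrix}\Phi_{11} & \Phi_{12}\\ \Phi_{12}^\top & \Phi_{22}\end{bmatrix}\begin{bmatrix} I & X_+\\ 0 & -X_-\\ 0 & -U_-\\ 0 & 0\end{bmatrix}^\top\ge 0$$ (block rows/columns of sizes $n,n,m,n$). Moreover, if $P,L$ (together with some $\alpha\ge0,\beta>0$) satisfy this inequality, then $K:=LP^{-1}$ satisfies $P-(A+BK)P(A+BK)^\top>0$ for all $(A,B)\in\Sigma$; in particular $A+BK$ is Schur stable for all $(A,B)\in\Sigma$.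
   Context: Consider the system $x(t+1)=A_sx(t)+B_su(t)+w(t)$ with unknown $A_s\in\mathbb{R}^{n\times n}$, $B_s\in\mathbb{R}^{n\times m}$ and unknown noise $w$. Data: $X_+=[x(1)\ \cdots\ x(T)]$, $X_-=[x(0)\ \cdots\ x(T-1)]$, $U_-=[u(0)\ \cdots\ u(T-1)]$, with $X_+=A_sX_-+B_sU_-+W_-$ where $W_-=[w(0)\ \cdots\ w(T-1)]$ satisfies $\begin{bmatrix} I\\ W_-^\top\end{bmatrix}^\top\begin{bmatrix}\Phi_{11} & \Phi_{12}\\ \Phi_{12}^\top & \Phi_{22}\end{bmatrix}\begin{bmatrix} I\\ W_-^\top\end{bmatrix}\ge0$ for known $\Phi_{11}=\Phi_{11}^\top\in\mathbb{R}^{n\times n}$, $\Phi_{12}\in\mathbb{R}^{n\times T}$, $\Phi_{22}=\Phi_{22}^\top\in\mathbb{R}^{T\times T}$, $\Phi_{22}<0$. $\Sigma$ is the set of all $(A,B)$ such that $X_+=AX_-+BU_-+W$ for some $W\in\mathbb{R}^{n\times T}$ satisfying the same noise inequality. Define the symmetric matrix $N:=\begin{bmatrix} I & X_+\\ 0 & -X_-\\ 0 & -U_-\end{bmatrix}\begin{bmatrix}\Phi_{11} & \Phi_{12}\\ \Phi_{12}^\top & \Phi_{22}\end{bmatrix}\begin{bmatrix} I & X_+\\ 0 & -X_-\\ 0 & -U_-\end{bmatrix}^\top\in\mathbb{R}^{(2n+m)\times(2n+m)}$, where in $\begin{bmatrix} I\\ \bar Z\end{bmatrix}$ the identity is $n\times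 n$. The data $(U_-,X)$ are called informative for quadratic stabilization if there exist $K\in\mathbb{R}^{m\times n}$ and symmetric $P>0$ with $P-(A+BK)P(A+BK)^\top>0$ for all $(A,B)\in\Sigma$. *)

theory Defs
  imports "Jordan_Normal_Form.Gauss_Jordan_Elimination" "Jordan_Normal_Form.Char_Poly"
begin

definition psd_mat :: "nat \<Rightarrow> real mat \<Rightarrow> bool" where
  "psd_mat k A \<longleftrightarrow> A \<in> carrier_mat k k \<and> transpose_mat A = A \<and>
     (\<forall>v \<in> carrier_vec k. 0 \<le> v \<bullet> (A *\<^sub>v v))"

definition pd_mat :: "nat \<Rightarrow> real mat \<Rightarrow> bool" where
  "pd_mat k A \<longleftrightarrow> A \<in> carrier_mat k k \<and> transpose_mat A = A \<and>
     (\<forall>v \<in> carrier_vec k. v \<noteq> 0\<^sub>v k \<longrightarrow> 0 < v \<bullet> (A *\<^sub>v v))"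

definition schur_stable :: "real mat \<Rightarrow> bool" where
  "schur_stable A \<longleftrightarrow> (\<forall>z. eigenvalue (map_mat complex_of_real A) z \<longrightarrow> cmod z < 1)"

definition Phi_mat :: "real mat \<Rightarrow> real mat \<Rightarrow> real mat \<Rightarrow> real mat" where
  "Phi_mat P11 P12 P22 = four_block_mat P11 P12 (transpose_mat P12) P22"

definition noise_ok :: "nat \<Rightarrow> real mat \<Rightarrow> real mat \<Rightarrow> real mat \<Rightarrow> real mat \<Rightarrow> bool" where
  "noise_ok n P11 P12 P22 W \<longleftrightarrow>
     psd_mat n (transpose_mat (1\<^sub>m n @\<^sub>r transpose_mat W) * Phi_mat P11 P12 P22 *
                (1\<^sub>m n @\<^sub>r transpose_mat W))"

definition Sigma_set :: "nat \<Rightarrow> nat \<Rightarrow> nat \<Rightarrow> real mat \<Rightarrow> real mat \<Rightarrow> real mat \<Rightarrow>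
    real mat \<Rightarrow> real mat \<Rightarrow> real mat \<Rightarrow> (real mat \<times> real mat) set" where
  "Sigma_set n m T Xp Xm Um P11 P12 P22 =
     {(A, B). A \<in> carrier_mat n n \<and> B \<in> carrier_mat n m \<and>
        (\<exists>W \<in> carrier_mat n T. Xp = A * Xm + B * Um + W \<and> noise_ok n P11 P12 P22 W)}"

definition informative_qs :: "nat \<Rightarrow> nat \<Rightarrow> nat \<Rightarrow> real mat \<Rightarrow> real mat \<Rightarrow> real mat \<Rightarrow>
    real mat \<Rightarrow> real mat \<Rightarrow> real mat \<Rightarrow> bool" where
  "informative_qs n m T Xp Xm Um P11 P12 P22 \<longleftrightarrow>
     (\<exists>K \<in> carrier_mat m n. \<exists>P. pd_mat n P \<and>
        (\<forall>(A, B) \<in> Sigma_set n m T Xp Xm Um P11 P12 P22.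
           pd_mat n (P - (A + B * K) * P * transpose_mat (A + B * K))))"

definition N_mat :: "nat \<Rightarrow> nat \<Rightarrow> real mat \<Rightarrow> real mat \<Rightarrow> real mat \<Rightarrow>
    real mat \<Rightarrow> real mat \<Rightarrow> real mat \<Rightarrow> real mat" where
  "N_mat n m Xp Xm Um P11 P12 P22 =
     (let M = four_block_mat (1\<^sub>m n) Xp (0\<^sub>m (n + m) n) ((- Xm) @\<^sub>r (- Um))
      in M * Phi_mat P11 P12 P22 * transpose_mat M)"

definition N4_mat :: "nat \<Rightarrow> nat \<Rightarrow> nat \<Rightarrow> real mat \<Rightarrow> real mat \<Rightarrow> real mat \<Rightarrow>
    real mat \<Rightarrow> real mat \<Rightarrow> real mat \<Rightarrow> real mat" where
  "N4_mat n m T Xp Xm Um P11 P12 P22 =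
     (let M = four_block_mat (1\<^sub>m n) Xp (0\<^sub>m (n + n + m) n)
                ((- Xm) @\<^sub>r (- Um) @\<^sub>r 0\<^sub>m n T)
      in M * Phi_mat P11 P12 P22 * transpose_mat M)"

definition LMI_block :: "nat \<Rightarrow> nat \<Rightarrow> real mat \<Rightarrow> real mat \<Rightarrow> real \<Rightarrow> real mat" where
  "LMI_block n m P L \<beta> =
     four_block_mat
       (four_block_mat (P - \<beta> \<cdot>\<^sub>m 1\<^sub>m n) (0\<^sub>m n n) (0\<^sub>m n n) (- P))
       (four_block_mat (0\<^sub>m n m) (0\<^sub>m n n) (- transpose_mat L) (0\<^sub>m n n))
       (four_block_mat (0\<^sub>m m n) (- L) (0\<^sub>m n n) (0\<^sub>m n n))
       (four_block_mat (0\<^sub>m m m) L (transpose_mat L) P)"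

end

theory Submission
  imports Defs
begin

text \<open>
  Write \<open>f\<close> for the quadratic form of \<open>diag(P, -[I;K] P [I;K]\<^sup>T)\<close> and \<open>g\<close> for that of \<open>N\<close>. Then
  \<open>(A, B) \<in> \<Sigma>\<close> says that \<open>g(v, Z v) \<ge> 0\<close> for all \<open>v\<close>, where \<open>Z = [A B]\<^sup>T\<close>, and the Lyapunov inequality
  says that \<open>f(v, Z v) > 0\<close> for all \<open>v \<noteq> 0\<close>. With \<open>L = K P\<close>, completing the square in the last block
  variable \<open>w\<close> turns the form of the LMI into
  \<open>f - \<beta> |x|\<^sup>2 - \<alpha> g + (w + K\<^sup>T z)\<^sup>T P (w + K\<^sup>T z)\<close>, so sufficiency is immediate.

  Necessity is a strict matrix S-lemma. Under the Slater condition, every pair \<open>(x\<^sub>1, x\<^sub>2)\<close> with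
  \<open>x\<^sub>1 \<noteq> 0\<close> and \<open>g \<ge> 0\<close> lies on the graph of some admissible \<open>Z\<close>, hence \<open>f > 0\<close> there. As \<open>f\<close> and \<open>g\<close>
  do not change along the kernel of \<open>N\<close> inside \<open>{x\<^sub>1 = 0}\<close>, compactness of the unit sphere of the
  orthogonal complement gives \<open>f \<ge> \<beta> |x\<^sub>1|\<^sup>2\<close> on \<open>{g \<ge> 0}\<close>, and the scalar S-lemma supplies \<open>\<alpha>\<close>.
\<close>

section \<open>Quadratic forms and the scalar S-lemma\<close>

definition bf :: "real mat \<Rightarrow> real vec \<Rightarrow> real vec \<Rightarrow> real" where
  "bf A x y = x \<bullet> (A *\<^sub>v y)"

lemma bf_sym:
  assumes "A \<in> carrier_mat d d" "A\<^sup>T = A" "x \<in> carrier_vec d" "y \<in> carrier_vec d"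
  shows "bf A x y = bf A y x"
  unfolding bf_def by (metis assms comm_scalar_prod mult_mat_vec_carrier transpose_vec_mult_scalar)

lemma bf_add_smult_left:
  assumes "A \<in> carrier_mat d d" "x \<in> carrier_vec d" "y \<in> carrier_vec d" "z \<in> carrier_vec d"
  shows "bf A (x + t \<cdot>\<^sub>v y) z = bf A x z + t * bf A y z"
  using assms unfolding bf_def by (subst add_scalar_prod_distrib[of _ d]) auto

lemma bf_add_smult_right:
  assumes "A \<in> carrier_mat d d" "x \<in> carrier_vec d" "y \<in> carrier_vec d" "z \<in> carrier_vec d"
  shows "bf A z (x + t \<cdot>\<^sub>v y) = bf A z x + t * bf A z y"
  using assms unfolding bf_def
  by (simp add: mult_add_distrib_mat_vec[of _ d d] mult_mat_vec[of _ d d] scalar_prod_add_distrib[of _ d])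

lemma bf_expand:
  assumes "A \<in> carrier_mat d d" "A\<^sup>T = A" "x \<in> carrier_vec d" "y \<in> carrier_vec d"
  shows "bf A (x + t \<cdot>\<^sub>v y) (x + t \<cdot>\<^sub>v y) = bf A x x + 2 * t * bf A x y + t\<^sup>2 * bf A y y"
  using assms bf_sym[OF assms]
  by (simp add: bf_add_smult_left[of _ d] bf_add_smult_right[of _ d] power2_eq_square algebra_simps)

lemma bf_carrier_add_smult:
  assumes "x \<in> carrier_vec d" "y \<in> carrier_vec d"
  shows "x + t \<cdot>\<^sub>v y \<in> carrier_vec d"
  using assms by simp

lemma bf_smult:
  assumes "A \<in> carrier_mat d d" "x \<in> carrier_vec d"
  shows "bf A (c \<cdot>\<^sub>v x) (c \<cdot>\<^sub>v x) = c\<^sup>2 * bf A x x"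
  using assms unfolding bf_def by (simp add: mult_mat_vec[of _ d d] power2_eq_square)

lemma smult_mat_mult_vec:
  fixes A :: "real mat"
  assumes "A \<in> carrier_mat k n" "v \<in> carrier_vec n"
  shows "(c \<cdot>\<^sub>m A) *\<^sub>v v = c \<cdot>\<^sub>v (A *\<^sub>v v)"
  using assms by (intro eq_vecI) auto

lemma transpose_smult: "(c \<cdot>\<^sub>m A)\<^sup>T = c \<cdot>\<^sub>m A\<^sup>T"
  by (intro eq_matI) auto

lemma scalar_prod_self_nonneg: "0 \<le> (x :: real vec) \<bullet> x"
  by (simp add: scalar_prod_def sum_nonneg)

lemma scalar_prod_self_eq_0:
  assumes "(x :: real vec) \<in> carrier_vec d" "x \<bullet> x = 0"
  shows "x = 0\<^sub>v d"
  using assms by (intro eq_vecI) (auto simp: scalar_prod_def sum_nonneg_eq_0_iff)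

text \<open>Two-dimensional core of the S-lemma: the coefficients are those of two forms along the
  line x + t y. As p < 0 < r, the first quadratic has two real roots; the second is nonnegative at
  both, and a positive combination of these two inequalities compares the ratios of the forms at x
  and y.\<close>

lemma quadratic_pair_ratio:
  fixes a b c p q r :: real
  assumes p: "p < 0" and r: "r > 0"
    and imp: "\<And>t. 0 \<le> p + 2 * t * q + t\<^sup>2 * r \<Longrightarrow> 0 \<le> a + 2 * t * b + t\<^sup>2 * c"
  shows "a / p \<le> c / r"
proof -
  define s where "s = sqrt (q\<^sup>2 - p * r)"
  have "p * r < 0" using p r by (simp add: mult_neg_pos)
  then have s2: "s\<^sup>2 = q\<^sup>2 - p * r"
    unfolding s_def by (simp add: order.trans[OF less_imp_le zero_le_power2])
  have "sqrt (q\<^sup>2) < s"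
    unfolding s_def using \<open>p * r < 0\<close> by (simp only: real_sqrt_less_iff)
  then have sq: "\<bar>q\<bar> < s" by simp
  \<comment> \<open>\<open>e / r\<close> runs over the roots of \<open>p + 2 t q + t\<^sup>2 r\<close>; the weights \<open>s + q\<close>, \<open>s - q\<close> below cancel \<open>b\<close>.\<close>
  have root: "0 \<le> r\<^sup>2 * a + 2 * r * e * b + e\<^sup>2 * c" if "e\<^sup>2 = - 2 * q * e - p * r" for e
  proof -
    have "p + 2 * (e / r) * q + (e / r)\<^sup>2 * r = 0"
      using r that by (simp add: field_simps power2_eq_square)
    then have "0 \<le> r\<^sup>2 * (a + 2 * (e / r) * b + (e / r)\<^sup>2 * c)"
      using imp[of "e / r"] by simp
    also have "\<dots> = r\<^sup>2 * a + 2 * r * e * b + e\<^sup>2 * c"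
      using r by (simp add: field_simps power2_eq_square)
    finally show ?thesis .
  qed
  have e: "(s - q)\<^sup>2 = - 2 * q * (s - q) - p * r" "(- q - s)\<^sup>2 = - 2 * q * (- q - s) - p * r"
    using s2 by (simp_all add: power2_eq_square algebra_simps)
  have "0 \<le> (s + q) * (r\<^sup>2 * a + 2 * r * (s - q) * b + (s - q)\<^sup>2 * c)"
       "0 \<le> (s - q) * (r\<^sup>2 * a + 2 * r * (- q - s) * b + (- q - s)\<^sup>2 * c)"
    using sq root[OF e(1)] root[OF e(2)] by (intro mult_nonneg_nonneg; linarith)+
  then have "0 \<le> (s + q) * (r\<^sup>2 * a + 2 * r * (s - q) * b + (s - q)\<^sup>2 * c)
       + (s - q) * (r\<^sup>2 * a + 2 * r * (- q - s) * b + (- q - s)\<^sup>2 * c)" by linarith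
  also have "\<dots> = 2 * s * (r\<^sup>2 * a + (s\<^sup>2 - q\<^sup>2) * c)"
    by (simp add: power2_eq_square algebra_simps)
  also have "\<dots> = (2 * s * r) * (r * a - p * c)"
    unfolding s2 by (simp add: power2_eq_square algebra_simps)
  finally have "0 \<le> (2 * s * r) * (r * a - p * c)" .
  moreover have "0 < 2 * s * r" using sq r by simp
  ultimately have "p * c \<le> r * a" by (simp add: zero_le_mult_iff)
  then show ?thesis using p r by (simp add: field_simps)
qed

text \<open>The multiplier is the infimum of the ratio of the two forms over the vectors with
  positive \<open>N\<close>-form; \<open>x0\<close> makes this set of ratios nonempty and
  \<open>imp\<close> makes it nonnegative. Where the \<open>N\<close>-form is negative,
  \<open>quadratic_pair_ratio\<close> shows that every such ratio, hence also the infimum, dominates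
  the ratio at that vector.\<close>

lemma S_lemma:
  assumes M: "M \<in> carrier_mat d d" "M\<^sup>T = M" and N: "N \<in> carrier_mat d d" "N\<^sup>T = N"
    and x0: "x0 \<in> carrier_vec d" "0 < bf N x0 x0"
    and imp: "\<And>x. x \<in> carrier_vec d \<Longrightarrow> 0 \<le> bf N x x \<Longrightarrow> 0 \<le> bf M x x"
  obtains \<alpha> where "\<alpha> \<ge> 0" "\<And>x. x \<in> carrier_vec d \<Longrightarrow> \<alpha> * bf N x x \<le> bf M x x"
proof -
  define R where "R = {bf M y y / bf N y y | y. y \<in> carrier_vec d \<and> 0 < bf N y y}"
  have ne: "R \<noteq> {}" using x0 unfolding R_def by blast
  have pos: "0 \<le> z" if "z \<in> R" for z
    using that imp unfolding R_def by fastforce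
  then have bdd: "bdd_below R" by (meson bdd_belowI)
  show ?thesis
  proof
    show "0 \<le> Inf R" using ne pos by (rule cInf_greatest)
    fix x :: "real vec" assume x: "x \<in> carrier_vec d"
    consider "bf N x x > 0" | "bf N x x = 0" | "bf N x x < 0" by linarith
    then show "Inf R * bf N x x \<le> bf M x x"
    proof cases
      case 1
      then have "Inf R \<le> bf M x x / bf N x x"
        using x by (intro cInf_lower bdd) (auto simp: R_def)
      then show ?thesis using 1 by (simp add: field_simps)
    next
      case 2
      then show ?thesis using imp[OF x] by simp
    next
      case 3
      have "bf M x x / bf N x x \<le> Inf R"
      proof (rule cInf_greatest[OF ne])
        fix z assume "z \<in> R"
        then obtain y where y: "y \<in> carrier_vec d" "0 < bf N y y" and z: "z = bf M y y / bf N y y"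
          unfolding R_def by blast
        show "bf M x x / bf N x x \<le> z" unfolding z
          using 3 y(2)
        proof (rule quadratic_pair_ratio)
          fix t assume "0 \<le> bf N x x + 2 * t * bf N x y + t\<^sup>2 * bf N y y"
          then show "0 \<le> bf M x x + 2 * t * bf M x y + t\<^sup>2 * bf M y y"
            using imp[OF bf_carrier_add_smult[OF x y(1), of t]]
            by (simp only: bf_expand[OF M x y(1)] bf_expand[OF N x y(1)])
        qed
      qed
      then show ?thesis using 3 by (simp add: field_simps)
    qed
  qed
qed

section \<open>Orthogonal decomposition and compactness\<close>

text \<open>Gram-Schmidt projection of x onto the span of \<open>as\<close>. Membership of p in the
  span is expressed by duality: p is orthogonal to everything that is orthogonal to
  \<open>as\<close>.\<close>

lemma orthogonal_decomposition:
  fixes as :: "real vec list" and x :: "real vec"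
  assumes "set as \<subseteq> carrier_vec d" "x \<in> carrier_vec d"
  obtains p where "p \<in> carrier_vec d" "\<And>a. a \<in> set as \<Longrightarrow> a \<bullet> (x - p) = 0"
    "\<And>k. k \<in> carrier_vec d \<Longrightarrow> (\<And>a. a \<in> set as \<Longrightarrow> a \<bullet> k = 0) \<Longrightarrow> p \<bullet> k = 0"
  using assms
proof (induction as arbitrary: x thesis)
  case Nil
  show ?case by (rule Nil(1)[of "0\<^sub>v d"]) auto
next
  case (Cons a as)
  then have a: "a \<in> carrier_vec d" and as: "set as \<subseteq> carrier_vec d" and x: "x \<in> carrier_vec d" by auto
  obtain p where p: "p \<in> carrier_vec d" "\<And>b. b \<in> set as \<Longrightarrow> b \<bullet> (x - p) = 0"
    "\<And>k. k \<in> carrier_vec d \<Longrightarrow> (\<And>b. b \<in> set as \<Longrightarrow> b \<bullet> k = 0) \<Longrightarrow> p \<bullet> k = 0"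
    using Cons.IH as x by metis
  obtain r where r: "r \<in> carrier_vec d" "\<And>b. b \<in> set as \<Longrightarrow> b \<bullet> (a - r) = 0"
    "\<And>k. k \<in> carrier_vec d \<Longrightarrow> (\<And>b. b \<in> set as \<Longrightarrow> b \<bullet> k = 0) \<Longrightarrow> r \<bullet> k = 0"
    using Cons.IH as a by metis
  \<comment> \<open>The part of the new vector that is orthogonal to \<open>as\<close>; the
    induction hypothesis is used a second time, to project a itself.\<close>
  define a' where "a' = a - r"
  have a': "a' \<in> carrier_vec d" unfolding a'_def using a r by simp
  have split: "a \<bullet> k = a' \<bullet> k + r \<bullet> k" if "k \<in> carrier_vec d" for k
    unfolding a'_def using that a r by (simp add: minus_scalar_prod_distrib[of _ d])
  \<comment> \<open>If \<open>a'\<close> is zero, then a adds nothing to the span; division by zero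
    gives t = 0 and p is kept.\<close>
  define t where "t = a' \<bullet> (x - p) / (a' \<bullet> a')"
  define p' where "p' = p + t \<cdot>\<^sub>v a'"
  have p': "p' \<in> carrier_vec d" unfolding p'_def using p a' by simp
  have diff: "b \<bullet> (x - p') = b \<bullet> (x - p) - t * (b \<bullet> a')" if "b \<in> carrier_vec d" for b
  proof -
    have "x - p' = (x - p) - t \<cdot>\<^sub>v a'" unfolding p'_def using x p a' by (auto intro!: eq_vecI)
    then show ?thesis using that x p a' by (simp add: scalar_prod_minus_distrib[of _ d])
  qed
  have as0: "b \<bullet> (x - p') = 0" if "b \<in> set as" for b
    using that as p(2) r(2) diff[of b] unfolding a'_def by auto
  have "a' \<bullet> (x - p') = 0"
  proof (cases "a' \<bullet> a' = 0")
    case True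
    then have "a' = 0\<^sub>v d" using scalar_prod_self_eq_0[OF a'] by simp
    then show ?thesis using x p' by simp
  next
    case False
    then show ?thesis using diff[OF a'] unfolding t_def by simp
  qed
  moreover have "r \<bullet> (x - p') = 0" using r(3) as0 x p' by simp
  ultimately have a0: "a \<bullet> (x - p') = 0" using split x p' by simp
  show ?case
  proof (rule Cons.prems(1)[OF p'])
    fix b assume "b \<in> set (a # as)"
    then show "b \<bullet> (x - p') = 0" using as0 a0 by auto
  next
    fix k :: "real vec" assume k: "k \<in> carrier_vec d" "\<And>b. b \<in> set (a # as) \<Longrightarrow> b \<bullet> k = 0"
    then have "p \<bullet> k = 0" "r \<bullet> k = 0" "a \<bullet> k = 0" using p(3) r(3) by auto
    then show "p' \<bullet> k = 0"
      unfolding p'_def using split[OF k(1)] p a' k(1) by (simp add: add_scalar_prod_distrib[of _ d])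
  qed
qed

text \<open>Bolzano-Weierstrass with entrywise convergence. The induction runs over the number e of
  coordinates that already converge: a monotone subsequence settles the next one, and passing to it
  preserves the earlier limits.\<close>

lemma bounded_vec_subsequence:
  fixes X :: "nat \<Rightarrow> real vec"
  assumes "\<And>k i. i < d \<Longrightarrow> \<bar>X k $ i\<bar> \<le> C"
  obtains r x where "strict_mono (r :: nat \<Rightarrow> nat)" "x \<in> carrier_vec d"
    "\<And>i. i < d \<Longrightarrow> (\<lambda>k. X (r k) $ i) \<longlonglongrightarrow> x $ i"
proof -
  have "\<exists>r :: nat \<Rightarrow> nat. strict_mono r \<and> (\<forall>i<e. convergent (\<lambda>k. X (r k) $ i))" if "e \<le> d" for e
    using that
  proof (induction e)
    case 0
    show ?case by (auto intro!: exI[of _ id] simp: strict_mono_def)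
  next
    case (Suc e)
    then obtain r :: "nat \<Rightarrow> nat" where r: "strict_mono r" "\<And>i. i < e \<Longrightarrow> convergent (\<lambda>k. X (r k) $ i)" by auto
    obtain s :: "nat \<Rightarrow> nat" where s: "strict_mono s" "monoseq (\<lambda>k. X (r (s k)) $ e)"
      using seq_monosub[of "\<lambda>k. X (r k) $ e"] by auto
    have "Bseq (\<lambda>k. X (r (s k)) $ e)"
      by (rule BseqI'[of _ C]) (use assms[of e] Suc.prems in auto)
    then have e: "convergent (\<lambda>k. X (r (s k)) $ e)" using s(2) by (rule Bseq_monoseq_convergent)
    show ?case
    proof (intro exI[of _ "r \<circ> s"] conjI allI impI)
      show "strict_mono (r \<circ> s)" using r(1) s(1) by (rule strict_mono_o)
      fix i assume "i < Suc e"
      then consider "i < e" | "i = e" by linarith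
      then show "convergent (\<lambda>k. X ((r \<circ> s) k) $ i)"
      proof cases
        case 1
        then show ?thesis using convergent_subseq_convergent[OF r(2) s(1)] by (simp add: o_def)
      next
        case 2
        then show ?thesis using e by (simp add: o_def)
      qed
    qed
  qed
  from this[of d] obtain r :: "nat \<Rightarrow> nat" where r: "strict_mono r" "\<And>i. i < d \<Longrightarrow> convergent (\<lambda>k. X (r k) $ i)"
    by auto
  show ?thesis
  proof
    show "strict_mono r" by (rule r)
    show "vec d (\<lambda>i. lim (\<lambda>k. X (r k) $ i)) \<in> carrier_vec d" by simp
    show "(\<lambda>k. X (r k) $ i) \<longlonglongrightarrow> vec d (\<lambda>i. lim (\<lambda>k. X (r k) $ i)) $ i" if "i < d" for i
      using r(2)[OF that] that by (simp add: convergent_LIMSEQ_iff)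
  qed
qed

lemma tendsto_scalar_prod:
  fixes X Y :: "nat \<Rightarrow> real vec"
  assumes "\<And>k. X k \<in> carrier_vec d" "\<And>k. Y k \<in> carrier_vec d" "x \<in> carrier_vec d" "y \<in> carrier_vec d"
    and "\<And>i. i < d \<Longrightarrow> (\<lambda>k. X k $ i) \<longlonglongrightarrow> x $ i" "\<And>i. i < d \<Longrightarrow> (\<lambda>k. Y k $ i) \<longlonglongrightarrow> y $ i"
  shows "(\<lambda>k. X k \<bullet> Y k) \<longlonglongrightarrow> x \<bullet> y"
  unfolding scalar_prod_def carrier_vecD[OF assms(2)] carrier_vecD[OF assms(4)]
  by (intro tendsto_sum tendsto_mult assms(5,6)) auto

lemma tendsto_bf:
  fixes X :: "nat \<Rightarrow> real vec"
  assumes A: "A \<in> carrier_mat d d" and X: "\<And>k. X k \<in> carrier_vec d" and x: "x \<in> carrier_vec d"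
    and lim: "\<And>i. i < d \<Longrightarrow> (\<lambda>k. X k $ i) \<longlonglongrightarrow> x $ i"
  shows "(\<lambda>k. bf A (X k) (X k)) \<longlonglongrightarrow> bf A x x"
  unfolding bf_def
proof (rule tendsto_scalar_prod[of _ d])
  fix i assume "i < d"
  then have "(\<lambda>k. row A i \<bullet> X k) \<longlonglongrightarrow> row A i \<bullet> x"
    using A X x lim by (intro tendsto_scalar_prod[of _ d]) auto
  then show "(\<lambda>k. (A *\<^sub>v X k) $ i) \<longlonglongrightarrow> (A *\<^sub>v x) $ i" using \<open>i < d\<close> A by simp
qed (use assms in auto)

section \<open>Graphs of admissible gains\<close>

lemma outer_mult_vec:
  fixes c w :: "real vec"
  assumes "c \<in> carrier_vec n" "w \<in> carrier_vec q" "v \<in> carrier_vec n"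
  shows "mat q n (\<lambda>(i, j). w $ i * c $ j) *\<^sub>v v = (c \<bullet> v) \<cdot>\<^sub>v w"
  using assms by (intro eq_vecI) (auto simp: scalar_prod_def sum_distrib_left sum_distrib_right ac_simps)

lemma append_add_smult:
  fixes a b c d :: "real vec"
  assumes "a \<in> carrier_vec n" "c \<in> carrier_vec n" "b \<in> carrier_vec q" "d \<in> carrier_vec q"
  shows "(a @\<^sub>v b) + t \<cdot>\<^sub>v (c @\<^sub>v d) = (a + t \<cdot>\<^sub>v c) @\<^sub>v (b + t \<cdot>\<^sub>v d)"
  using assms by (intro eq_vecI) (auto simp: append_vec_def)

lemma mult_add_smult:
  fixes A :: "real mat"
  assumes "A \<in> carrier_mat k n" "x \<in> carrier_vec n" "y \<in> carrier_vec n"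
  shows "A *\<^sub>v (x + t \<cdot>\<^sub>v y) = A *\<^sub>v x + t \<cdot>\<^sub>v (A *\<^sub>v y)"
  using assms by (simp add: mult_add_distrib_mat_vec[of _ k n] mult_mat_vec[of _ k n])

text \<open>Turns a statement about all admissible gains into one about single vectors. A rank-one
  change of the Slater gain \<open>Zb\<close> bends its graph through (x1, x2); each vector of the
  new graph is an \<open>N\<close>-orthogonal sum of a vector on the old graph and a multiple of
  (x1, x2), so its form is a sum of two nonnegative terms.\<close>

lemma interpolating_gain:
  assumes N: "N \<in> carrier_mat (n + q) (n + q)" "N\<^sup>T = N"
    and neg: "\<And>w. w \<in> carrier_vec q \<Longrightarrow> bf N (0\<^sub>v n @\<^sub>v w) (0\<^sub>v n @\<^sub>v w) \<le> 0"
    and Zb: "Zb \<in> carrier_mat q n"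
    and pos: "\<And>v. v \<in> carrier_vec n \<Longrightarrow> v \<noteq> 0\<^sub>v n \<Longrightarrow> 0 < bf N (v @\<^sub>v Zb *\<^sub>v v) (v @\<^sub>v Zb *\<^sub>v v)"
    and x1: "x1 \<in> carrier_vec n" "x1 \<noteq> 0\<^sub>v n" and x2: "x2 \<in> carrier_vec q"
    and x: "0 \<le> bf N (x1 @\<^sub>v x2) (x1 @\<^sub>v x2)"
  obtains Z where "Z \<in> carrier_mat q n" "Z *\<^sub>v x1 = x2"
    "\<And>v. v \<in> carrier_vec n \<Longrightarrow> 0 \<le> bf N (v @\<^sub>v Z *\<^sub>v v) (v @\<^sub>v Z *\<^sub>v v)"
proof -
  let ?x = "x1 @\<^sub>v x2"
  define w where "w = x2 + (-1) \<cdot>\<^sub>v (Zb *\<^sub>v x1)"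
  \<comment> \<open>The rank-one correction is chosen so that \<open>(v, Z v) = (u, Zb u) + s (x1, x2)\<close> with the two summands
    orthogonal with respect to \<open>N\<close>.\<close>
  define c where "c = (1\<^sub>m n @\<^sub>r Zb)\<^sup>T *\<^sub>v (N *\<^sub>v ?x)"
  define Z where "Z = Zb + mat q n (\<lambda>(i, j). w $ i * ((1 / (c \<bullet> x1)) \<cdot>\<^sub>v c) $ j)"
  have xc: "?x \<in> carrier_vec (n + q)" using x1 x2 by simp
  have w: "w \<in> carrier_vec q" unfolding w_def using x1 x2 Zb by simp
  have E: "1\<^sub>m n @\<^sub>r Zb \<in> carrier_mat (n + q) n" using Zb by (intro carrier_append_rows) auto
  then have c: "c \<in> carrier_vec n" unfolding c_def using N xc by simp
  have cv: "c \<bullet> v = bf N (v @\<^sub>v Zb *\<^sub>v v) ?x" if v: "v \<in> carrier_vec n" for v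
  proof -
    have "c \<bullet> v = (N *\<^sub>v ?x) \<bullet> ((1\<^sub>m n @\<^sub>r Zb) *\<^sub>v v)"
      unfolding c_def using transpose_vec_mult_scalar[OF E v] N xc by simp
    also have "(1\<^sub>m n @\<^sub>r Zb) *\<^sub>v v = v @\<^sub>v Zb *\<^sub>v v"
      using mat_mult_append[OF _ Zb v, of "1\<^sub>m n" n] v by simp
    finally show ?thesis
      unfolding bf_def using N xc v Zb by (simp add: comm_scalar_prod[of _ "n + q"])
  qed
  have Zv: "Z *\<^sub>v v = Zb *\<^sub>v v + (c \<bullet> v / (c \<bullet> x1)) \<cdot>\<^sub>v w" if v: "v \<in> carrier_vec n" for v
    unfolding Z_def using Zb v c w
    by (simp add: add_mult_distrib_mat_vec[of _ q n] outer_mult_vec del: index_smult_vec)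
  let ?e = "x1 @\<^sub>v Zb *\<^sub>v x1"
  have e: "?e \<in> carrier_vec (n + q)" using x1 Zb by simp
  have w0: "0\<^sub>v n @\<^sub>v w \<in> carrier_vec (n + q)" using w by simp
  have xe: "?x = ?e + 1 \<cdot>\<^sub>v (0\<^sub>v n @\<^sub>v w)"
    using x1 x2 Zb w unfolding w_def
    by (subst append_add_smult[of _ n _ _ q]) (auto intro!: arg_cong2[of _ _ _ _ append_vec] eq_vecI)
  \<comment> \<open>Twice the mixed term of e and x equals N(e) + N(x) - N(0, w), where N(e) > 0,
    N(x) \<ge> 0 and N(0, w) \<le> 0. So the denominator of the rank-one correction is
    positive.\<close>
  have "bf N ?x ?x = bf N ?e ?e + 2 * bf N ?e (0\<^sub>v n @\<^sub>v w) + bf N (0\<^sub>v n @\<^sub>v w) (0\<^sub>v n @\<^sub>v w)"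
    using bf_expand[OF N e w0, of 1] unfolding xe by simp
  moreover have "bf N ?e ?x = bf N ?e ?e + bf N ?e (0\<^sub>v n @\<^sub>v w)"
    using bf_add_smult_right[OF N(1) e w0 e, of 1] unfolding xe by simp
  ultimately have "0 < bf N ?e ?x" using pos[OF x1] neg[OF w] x by linarith
  then have cx: "0 < c \<bullet> x1" using cv[OF x1(1)] by simp
  show ?thesis
  proof
    show "Z \<in> carrier_mat q n" unfolding Z_def using Zb by simp
    show "Z *\<^sub>v x1 = x2" unfolding Zv[OF x1(1)] using cx x2 Zb x1 by (auto simp: w_def intro!: eq_vecI)
    fix v :: "real vec" assume v: "v \<in> carrier_vec n"
    define s where "s = c \<bullet> v / (c \<bullet> x1)"
    define u where "u = v + (- s) \<cdot>\<^sub>v x1"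
    let ?u = "u @\<^sub>v Zb *\<^sub>v u"
    have u: "u \<in> carrier_vec n" unfolding u_def using v x1 by simp
    then have u': "?u \<in> carrier_vec (n + q)" using Zb by simp
    have "v @\<^sub>v Z *\<^sub>v v = ?u + s \<cdot>\<^sub>v ?x"
      using u v x1 x2 Zb w unfolding Zv[OF v] s_def[symmetric]
      by (subst append_add_smult[of _ n _ _ q])
        (auto simp: u_def w_def mult_add_smult[of _ q n] algebra_simps
          intro!: arg_cong2[of _ _ _ _ append_vec] eq_vecI)
    moreover have "c \<bullet> u = 0"
      unfolding u_def s_def using cx c v x1
      by (simp add: scalar_prod_add_distrib[of _ n])
    ultimately have "bf N (v @\<^sub>v Z *\<^sub>v v) (v @\<^sub>v Z *\<^sub>v v) = bf N ?u ?u + s\<^sup>2 * bf N ?x ?x"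
      using bf_expand[OF N u' xc, of s] cv[OF u] by simp
    moreover have "0 \<le> bf N ?u ?u"
    proof (cases "u = 0\<^sub>v n")
      case True
      then have "?u = 0\<^sub>v (n + q)" using Zb by (auto intro!: eq_vecI simp: scalar_prod_def)
      then show ?thesis unfolding bf_def using N by simp
    next
      case False
      then show ?thesis using pos[OF u] by simp
    qed
    ultimately show "0 \<le> bf N (v @\<^sub>v Z *\<^sub>v v) (v @\<^sub>v Z *\<^sub>v v)" using x by simp
  qed
qed

section \<open>The strict matrix S-lemma\<close>

text \<open>A concave function that is bounded below on the whole line is constant.\<close>

lemma quadratic_nonneg_concave:
  fixes a b c :: real
  assumes "\<And>t. 0 \<le> a + 2 * t * b + t\<^sup>2 * c" "c \<le> 0"
  shows "b = 0" "c = 0"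
proof -
  have a: "0 \<le> a" using assms(1)[of 0] by simp
  show c: "c = 0"
  proof (rule ccontr)
    assume "c \<noteq> 0"
    then have c: "c < 0" using assms(2) by simp
    \<comment> \<open>At this s the quadratic term is -(a + 1); adding the values at s and -s
      cancels the linear term and leaves -2.\<close>
    define s where "s = sqrt ((a + 1) / (- c))"
    have "s\<^sup>2 * c = - (a + 1)" unfolding s_def using a c by (simp add: field_simps)
    then show False using assms(1)[of s] assms(1)[of "- s"] by simp
  qed
  show "b = 0"
  proof (rule ccontr)
    assume "b \<noteq> 0"
    \<comment> \<open>At this point the remaining affine function takes the value -1.\<close>
    then show False using assms(1)[of "- (a + 1) / (2 * b)"] c by (simp add: field_simps)
  qed
qed

text \<open>The quadratic has its minimum at t = 0, so its derivative 2 b vanishes there.\<close>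

lemma quadratic_nonneg_no_constant:
  fixes b c :: real
  assumes "\<And>t. 0 \<le> 2 * t * b + t\<^sup>2 * c" "0 \<le> c"
  shows "b = 0"
proof (rule ccontr)
  assume b: "b \<noteq> 0"
  \<comment> \<open>Dividing by c + 1 instead of c keeps the test point -b / e defined when c =
    0.\<close>
  define e where "e = c + 1"
  have e: "0 < e" "c = e - 1" unfolding e_def using assms(2) by auto
  have "2 * (- b / e) * b + (- b / e)\<^sup>2 * c = - (b\<^sup>2 * (e + 1) / e\<^sup>2)"
    unfolding e(2) using e(1) by (simp add: field_simps power2_eq_square)
  also have "\<dots> < 0" using b e(1) by simp
  finally show False using assms(1)[of "- b / e"] by simp
qed

text \<open>The scalar S-lemma is applied to the form of M lowered by \<beta> |x1|^2. The work lies
  in a uniform margin \<beta>: \<open>Nker\<close> turns each lower-block direction with vanishing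
  \<open>N\<close>-form into a kernel direction, which can be projected away before compactness is
  used. Positivity of n supplies a nonzero vector, and with it a point of positive
  \<open>N\<close>-form.\<close>

lemma strict_matrix_S_lemma:
  assumes n: "0 < n"
    and M: "M \<in> carrier_mat (n + q) (n + q)" "M\<^sup>T = M"
    and N: "N \<in> carrier_mat (n + q) (n + q)" "N\<^sup>T = N"
    and Mneg: "\<And>w. w \<in> carrier_vec q \<Longrightarrow> bf M (0\<^sub>v n @\<^sub>v w) (0\<^sub>v n @\<^sub>v w) \<le> 0"
    and Nneg: "\<And>w. w \<in> carrier_vec q \<Longrightarrow> bf N (0\<^sub>v n @\<^sub>v w) (0\<^sub>v n @\<^sub>v w) \<le> 0"
    and Nker: "\<And>w. w \<in> carrier_vec q \<Longrightarrow> bf N (0\<^sub>v n @\<^sub>v w) (0\<^sub>v n @\<^sub>v w) = 0 \<Longrightarrow>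
      N *\<^sub>v (0\<^sub>v n @\<^sub>v w) = 0\<^sub>v (n + q)"
    and Zb: "Zb \<in> carrier_mat q n"
    and pos: "\<And>v. v \<in> carrier_vec n \<Longrightarrow> v \<noteq> 0\<^sub>v n \<Longrightarrow> 0 < bf N (v @\<^sub>v Zb *\<^sub>v v) (v @\<^sub>v Zb *\<^sub>v v)"
    and imp: "\<And>Z v. Z \<in> carrier_mat q n \<Longrightarrow>
      (\<And>u. u \<in> carrier_vec n \<Longrightarrow> 0 \<le> bf N (u @\<^sub>v Z *\<^sub>v u) (u @\<^sub>v Z *\<^sub>v u)) \<Longrightarrow>
      v \<in> carrier_vec n \<Longrightarrow> v \<noteq> 0\<^sub>v n \<Longrightarrow> 0 < bf M (v @\<^sub>v Z *\<^sub>v v) (v @\<^sub>v Z *\<^sub>v v)"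
  obtains \<alpha> \<beta> where "\<alpha> \<ge> 0" "\<beta> > 0"
    "\<And>x1 x2. x1 \<in> carrier_vec n \<Longrightarrow> x2 \<in> carrier_vec q \<Longrightarrow>
      \<alpha> * bf N (x1 @\<^sub>v x2) (x1 @\<^sub>v x2) + \<beta> * (x1 \<bullet> x1) \<le> bf M (x1 @\<^sub>v x2) (x1 @\<^sub>v x2)"
proof -
  let ?d = "n + q"
  have Mpos: "0 < bf M (x1 @\<^sub>v x2) (x1 @\<^sub>v x2)"
    if "x1 \<in> carrier_vec n" "x1 \<noteq> 0\<^sub>v n" "x2 \<in> carrier_vec q" "0 \<le> bf N (x1 @\<^sub>v x2) (x1 @\<^sub>v x2)" for x1 x2
    using interpolating_gain[OF N Nneg Zb pos that] imp that(1,2) by metis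
  define k0 where "k0 w = 0\<^sub>v n @\<^sub>v w" for w :: "real vec"
  have k0[simp]: "k0 w \<in> carrier_vec ?d" if "w \<in> carrier_vec q" for w using that unfolding k0_def by simp
  have shift: "(v @\<^sub>v y) + t \<cdot>\<^sub>v k0 w = v @\<^sub>v (y + t \<cdot>\<^sub>v w)"
    if "v \<in> carrier_vec n" "y \<in> carrier_vec q" "w \<in> carrier_vec q" for v y w t
    unfolding k0_def using that by (subst append_add_smult[of _ n _ _ q]) auto
  have Nk: "bf N (x + t \<cdot>\<^sub>v k) (x + t \<cdot>\<^sub>v k) = bf N x x"
    if "N *\<^sub>v k = 0\<^sub>v ?d" "x \<in> carrier_vec ?d" "k \<in> carrier_vec ?d" for x k t
    using that unfolding bf_expand[OF N that(2,3)] by (simp add: bf_def)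
  \<comment> \<open>Along \<open>x + t k0 w\<close> the form of \<open>N\<close> is constant, so the form of \<open>M\<close> stays positive although it is
    concave in \<open>t\<close>; hence it is constant too.\<close>
  have Mk: "bf M (k0 w) (k0 w) = 0 \<and> (\<forall>y\<in>carrier_vec ?d. bf M y (k0 w) = 0)"
    if w: "w \<in> carrier_vec q" and Nw: "N *\<^sub>v k0 w = 0\<^sub>v ?d" for w
  proof -
    have "bf M (v @\<^sub>v Zb *\<^sub>v v) (k0 w) = 0 \<and> bf M (k0 w) (k0 w) = 0"
      if v: "v \<in> carrier_vec n" "v \<noteq> 0\<^sub>v n" for v
    proof -
      let ?v = "v @\<^sub>v Zb *\<^sub>v v"
      have v': "?v \<in> carrier_vec ?d" using v Zb by simp
      have "0 \<le> bf M ?v ?v + 2 * t * bf M ?v (k0 w) + t\<^sup>2 * bf M (k0 w) (k0 w)" for t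
        unfolding bf_expand[OF M v' k0[OF w], symmetric]
      proof -
        have "0 < bf N (?v + t \<cdot>\<^sub>v k0 w) (?v + t \<cdot>\<^sub>v k0 w)"
          using Nk[OF Nw v' k0[OF w]] pos[OF v] by simp
        then show "0 \<le> bf M (?v + t \<cdot>\<^sub>v k0 w) (?v + t \<cdot>\<^sub>v k0 w)"
          using Mpos[of v "Zb *\<^sub>v v + t \<cdot>\<^sub>v w"] v w Zb by (simp add: shift)
      qed
      from quadratic_nonneg_concave[OF this] Mneg[OF w] show ?thesis by (simp add: k0_def)
    qed
    note * = this
    have "unit_vec n 0 \<noteq> (0\<^sub>v n :: real vec)" using n by simp
    then have kk: "bf M (k0 w) (k0 w) = 0" using *[of "unit_vec n 0"] by simp
    \<comment> \<open>The form of -M is positive semidefinite on the lower block and vanishes at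
      \<open>k0 w\<close>; such a vector lies in the radical of the form on that block.\<close>
    have k0k: "bf M (k0 w) (k0 w') = 0" if w': "w' \<in> carrier_vec q" for w'
    proof -
      have "0 \<le> 2 * t * (- bf M (k0 w) (k0 w')) + t\<^sup>2 * (- bf M (k0 w') (k0 w'))" for t
        using bf_expand[OF M k0[OF w] k0[OF w'], of t] kk Mneg[of "w + t \<cdot>\<^sub>v w'"] w w'
        by (simp add: shift[OF zero_carrier_vec w w', folded k0_def] k0_def[symmetric])
      from quadratic_nonneg_no_constant[OF this] Mneg[OF w'] show ?thesis by (simp add: k0_def)
    qed
    have "bf M y (k0 w) = 0" if y: "y \<in> carrier_vec ?d" for y
    proof -
      define v z where "v = vec_first y n" and "z = vec_last y q"
      have vz: "v \<in> carrier_vec n" "z \<in> carrier_vec q" "y = v @\<^sub>v z"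
        unfolding v_def z_def using y by auto
      \<comment> \<open>Every y differs by a lower-block vector from a vector on the graph of
        \<open>Zb\<close>, or from zero if v = 0. Both parts are already known to be
        \<open>M\<close>-orthogonal to \<open>k0 w\<close>.\<close>
      define u where "u = (if v = 0\<^sub>v n then 0\<^sub>v q else Zb *\<^sub>v v)"
      have u: "u \<in> carrier_vec q" unfolding u_def using Zb vz by simp
      have z': "z + (-1) \<cdot>\<^sub>v u \<in> carrier_vec q" using vz u by simp
      have "v @\<^sub>v u \<in> carrier_vec ?d" using vz u by simp
      moreover have "y = (v @\<^sub>v u) + 1 \<cdot>\<^sub>v k0 (z + (-1) \<cdot>\<^sub>v u)"
        unfolding shift[OF vz(1) u z'] unfolding vz(3)
        using vz u by (auto intro!: arg_cong2[of _ _ _ _ append_vec] eq_vecI)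
      moreover have "bf M (v @\<^sub>v u) (k0 w) = 0"
      proof (cases "v = 0\<^sub>v n")
        case True
        then have "v @\<^sub>v u = 0\<^sub>v ?d" unfolding u_def by (auto intro!: eq_vecI)
        then show ?thesis unfolding bf_def using M w by simp
      next
        case False
        then show ?thesis using *[OF vz(1)] unfolding u_def by simp
      qed
      ultimately show ?thesis
        using bf_add_smult_left[OF M(1), of "v @\<^sub>v u" "k0 (z + (-1) \<cdot>\<^sub>v u)" "k0 w" 1]
          k0k[OF z'] bf_sym[OF M k0[OF w] k0[OF z']] z' w
        by simp
    qed
    then show ?thesis using kk by simp
  qed
  \<comment> \<open>The directions along which both forms are constant and x1 does not
    change.\<close>
  define R where "R = {k \<in> carrier_vec ?d. N *\<^sub>v k = 0\<^sub>v ?d \<and> vec_first k n = 0\<^sub>v n}"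
  have R_k0: "\<exists>w\<in>carrier_vec q. k = k0 w" if "k \<in> R" for k
    using that unfolding R_def k0_def
    by (intro bexI[of _ "vec_last k q"]) (auto, metis vec_first_last_append)
  \<comment> \<open>A compact set of representatives modulo R and scaling. Without orthogonality to
    R it could contain vectors of R, where the form of M vanishes.\<close>
  define S where "S = {p \<in> carrier_vec ?d. p \<bullet> p = 1 \<and> 0 \<le> bf N p p \<and> (\<forall>k\<in>R. p \<bullet> k = 0)}"
  \<comment> \<open>Otherwise a sequence in S whose \<open>M\<close>-values have upper bounds
    tending to 0 subconverges to some x in S with M(x) \<le> 0. By \<open>Mpos\<close> its upper
    part is zero, so N(x) = 0 and x lies in R by \<open>Nker\<close>; then x is orthogonal to
    itself, against x being a unit vector.\<close>
  have "\<exists>\<epsilon>>0. \<forall>p\<in>S. \<epsilon> \<le> bf M p p"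
  proof (rule ccontr)
    assume "\<not> ?thesis"
    then have "\<exists>p\<in>S. bf M p p < inverse (real (Suc k))" for k
      by (meson inverse_positive_iff_positive not_le of_nat_0_less_iff zero_less_Suc)
    then obtain X where XS: "\<And>k. X k \<in> S" and XM: "\<And>k. bf M (X k) (X k) < inverse (real (Suc k))"
      by metis
    have X: "X k \<in> carrier_vec ?d" for k using XS unfolding S_def by simp
    have "\<bar>X k $ i\<bar> \<le> 1" if "i < ?d" for k i
    proof -
      have "(X k $ i)\<^sup>2 \<le> X k \<bullet> X k"
        unfolding scalar_prod_def power2_eq_square using that X[of k]
        by (intro member_le_sum) auto
      then show ?thesis using XS[of k] unfolding S_def by (simp add: abs_square_le_1)
    qed
    from bounded_vec_subsequence[of ?d X 1, OF this] obtain r x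
      where r: "strict_mono (r :: nat \<Rightarrow> nat)" and x: "x \<in> carrier_vec ?d"
        and lim: "\<And>i. i < ?d \<Longrightarrow> (\<lambda>k. X (r k) $ i) \<longlonglongrightarrow> x $ i" by metis
    have "(\<lambda>k. X (r k) \<bullet> X (r k)) \<longlonglongrightarrow> x \<bullet> x"
      using X x lim by (intro tendsto_scalar_prod[of _ ?d]) auto
    then have xx: "x \<bullet> x = 1" using XS unfolding S_def by (simp add: LIMSEQ_const_iff)
    have "(\<lambda>k. bf N (X (r k)) (X (r k))) \<longlonglongrightarrow> bf N x x" using N(1) X x lim by (rule tendsto_bf)
    then have xN: "0 \<le> bf N x x" by (rule LIMSEQ_le_const) (use XS in \<open>auto simp: S_def\<close>)
    have xR: "x \<bullet> k = 0" if k: "k \<in> R" for k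
    proof -
      have "(\<lambda>j. X (r j) \<bullet> k) \<longlonglongrightarrow> x \<bullet> k"
        using X x lim k by (intro tendsto_scalar_prod[of _ ?d]) (auto simp: R_def)
      then show ?thesis using XS k unfolding S_def by (simp add: LIMSEQ_const_iff)
    qed
    have "(\<lambda>k. bf M (X (r k)) (X (r k))) \<longlonglongrightarrow> bf M x x" using M(1) X x lim by (rule tendsto_bf)
    moreover have "(\<lambda>k. inverse (real (Suc (r k)))) \<longlonglongrightarrow> 0"
      using LIMSEQ_subseq_LIMSEQ[OF LIMSEQ_inverse_real_of_nat r] by (simp add: o_def)
    ultimately have xM: "bf M x x \<le> 0"
      by (rule LIMSEQ_le) (use XM less_imp_le in blast)
    define v z where "v = vec_first x n" and "z = vec_last x q"
    have vz: "v \<in> carrier_vec n" "z \<in> carrier_vec q" "x = v @\<^sub>v z"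
      unfolding v_def z_def using x by auto
    have "v = 0\<^sub>v n" using Mpos[OF vz(1) _ vz(2)] xN xM unfolding vz(3) by force
    then have "N *\<^sub>v x = 0\<^sub>v ?d" using Nker[OF vz(2)] Nneg[OF vz(2)] xN unfolding vz(3) by simp
    then have "x \<in> R" unfolding R_def using x \<open>v = 0\<^sub>v n\<close> v_def by simp
    then show False using xR xx by simp
  qed
  then obtain \<epsilon> where \<epsilon>: "\<epsilon> > 0" "\<And>p. p \<in> S \<Longrightarrow> \<epsilon> \<le> bf M p p" by blast
  have bound: "\<epsilon> * (x1 \<bullet> x1) \<le> bf M (x1 @\<^sub>v x2) (x1 @\<^sub>v x2)"
    if x1: "x1 \<in> carrier_vec n" and x2: "x2 \<in> carrier_vec q"
      and xN: "0 \<le> bf N (x1 @\<^sub>v x2) (x1 @\<^sub>v x2)" for x1 x2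
  proof -
    define x where "x = x1 @\<^sub>v x2"
    have x: "x \<in> carrier_vec ?d" unfolding x_def using x1 x2 by simp
    \<comment> \<open>The common orthogonal complement of these vectors is R: the rows of N express
      the kernel condition, the unit vectors the vanishing of the first n entries. So p below is the
      projection of x onto the complement of R.\<close>
    define as where "as = rows N @ map (unit_vec ?d) [0..<n]"
    have as: "set as \<subseteq> carrier_vec ?d" unfolding as_def rows_def using N by auto
    have asR: "k \<in> R \<longleftrightarrow> (\<forall>a\<in>set as. a \<bullet> k = 0)" if "k \<in> carrier_vec ?d" for k
    proof -
      have "(\<forall>a\<in>set as. a \<bullet> k = 0) \<longleftrightarrow> (\<forall>i<?d. row N i \<bullet> k = 0) \<and> (\<forall>i<n. k $ i = 0)"
        unfolding as_def rows_def using that N by (auto simp: ball_Un)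
      then show ?thesis using that N unfolding R_def by (auto simp: vec_eq_iff vec_first_def)
    qed
    obtain p where p: "p \<in> carrier_vec ?d" "\<And>a. a \<in> set as \<Longrightarrow> a \<bullet> (x - p) = 0"
      "\<And>k. k \<in> carrier_vec ?d \<Longrightarrow> (\<And>a. a \<in> set as \<Longrightarrow> a \<bullet> k = 0) \<Longrightarrow> p \<bullet> k = 0"
      using orthogonal_decomposition[OF as x] by metis
    have kR: "x - p \<in> R" using asR p x by simp
    then obtain w where w: "w \<in> carrier_vec q" "x - p = k0 w" using R_k0 by blast
    have Nw: "N *\<^sub>v k0 w = 0\<^sub>v ?d" using kR w unfolding R_def by simp
    have xp: "x = p + 1 \<cdot>\<^sub>v k0 w" using w(2)[symmetric] x p(1) by (auto intro!: eq_vecI)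
    have fM: "bf M x x = bf M p p"
      unfolding xp bf_expand[OF M p(1) k0[OF w(1)]] using Mk[OF w(1) Nw] p(1) by simp
    have fN: "bf N x x = bf N p p" unfolding xp by (rule Nk[OF Nw p(1) k0[OF w(1)]])
    \<comment> \<open>Vectors of R vanish in the upper block, so the projection keeps x1 and |p| is
      at least |x1|.\<close>
    have "x1 = vec_first x n" unfolding x_def vec_first_def using x1 by (auto intro!: eq_vecI)
    also have "\<dots> = vec_first p n"
      unfolding xp k0_def vec_first_def using p(1) w(1) by (auto intro!: eq_vecI)
    finally have px: "p = x1 @\<^sub>v vec_last p q" using p(1) by simp
    have "p \<bullet> p = x1 \<bullet> x1 + vec_last p q \<bullet> vec_last p q"
      by (subst (1 2) px, subst scalar_prod_append[of _ n _ q]) (use x1 in auto)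
    then have pp: "x1 \<bullet> x1 \<le> p \<bullet> p" using scalar_prod_self_nonneg by simp
    \<comment> \<open>Both sides scale quadratically, so a nonzero p may be normalised into
      S.\<close>
    have "\<epsilon> * (p \<bullet> p) \<le> bf M p p"
    proof (cases "p \<bullet> p = 0")
      case True
      then have "p = 0\<^sub>v ?d" using scalar_prod_self_eq_0[OF p(1)] by simp
      then show ?thesis unfolding bf_def using M by simp
    next
      case False
      then have pos: "0 < p \<bullet> p" using scalar_prod_self_nonneg[of p] by simp
      define c where "c = 1 / sqrt (p \<bullet> p)"
      have c2: "c\<^sup>2 * (p \<bullet> p) = 1" "c\<^sup>2 > 0" unfolding c_def using pos by (simp_all add: power_divide)
      have "c \<cdot>\<^sub>v p \<in> S"
        unfolding S_def using p asR xN fN c2 bf_smult[OF N(1) p(1), of c] R_def unfolding x_def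
        by (auto simp: power2_eq_square)
      then have "\<epsilon> \<le> c\<^sup>2 * bf M p p" using \<epsilon>(2) bf_smult[OF M(1) p(1), of c] by metis
      then have "\<epsilon> * (c\<^sup>2 * (p \<bullet> p)) \<le> c\<^sup>2 * bf M p p" using c2(1) by simp
      then have "c\<^sup>2 * (\<epsilon> * (p \<bullet> p)) \<le> c\<^sup>2 * bf M p p" by (simp add: ac_simps)
      then show ?thesis using c2(2) by (rule mult_left_le_imp_le)
    qed
    moreover have "\<epsilon> * (x1 \<bullet> x1) \<le> \<epsilon> * (p \<bullet> p)" using \<epsilon>(1) pp by simp
    ultimately show ?thesis using fM unfolding x_def by linarith
  qed
  \<comment> \<open>Subtracting diag(\<epsilon> I, 0) moves the margin into the matrix, so that the
    nonstrict scalar S-lemma applies to M - E.\<close>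
  define E where "E = four_block_mat (\<epsilon> \<cdot>\<^sub>m 1\<^sub>m n) (0\<^sub>m n q) (0\<^sub>m q n) (0\<^sub>m q q)"
  have E: "E \<in> carrier_mat ?d ?d" "E\<^sup>T = E"
    unfolding E_def by (auto simp: transpose_four_block_mat[of _ n n _ q _ q] transpose_smult)
  have bfE: "bf (M - E) (x1 @\<^sub>v x2) (x1 @\<^sub>v x2) = bf M (x1 @\<^sub>v x2) (x1 @\<^sub>v x2) - \<epsilon> * (x1 \<bullet> x1)"
    if x: "x1 \<in> carrier_vec n" "x2 \<in> carrier_vec q" for x1 x2
  proof -
    have xc: "x1 @\<^sub>v x2 \<in> carrier_vec ?d" using x by simp
    have "E *\<^sub>v (x1 @\<^sub>v x2) = (\<epsilon> \<cdot>\<^sub>v x1) @\<^sub>v 0\<^sub>v q"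
      unfolding E_def by (subst mult_mat_vec_split[of _ n _ q]) (use x in \<open>auto simp: smult_mat_mult_vec[of _ n n]\<close>)
    then show ?thesis unfolding bf_def using x xc E M
      by (simp add: minus_mult_distrib_mat_vec[of _ ?d ?d] scalar_prod_minus_distrib[of _ ?d]
          scalar_prod_append[of _ n _ q])
  qed
  have e: "unit_vec n 0 \<in> carrier_vec n" "unit_vec n 0 \<noteq> (0\<^sub>v n :: real vec)" using n by auto
  have ME: "M - E \<in> carrier_mat ?d ?d" "(M - E)\<^sup>T = M - E"
    using M E by (auto simp: transpose_minus[of _ ?d ?d])
  have ME_nonneg: "0 \<le> bf (M - E) x x" if x: "x \<in> carrier_vec ?d" "0 \<le> bf N x x" for x
  proof -
    have "x = vec_first x n @\<^sub>v vec_last x q" using x(1) by simp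
    then show ?thesis
      using bfE[of "vec_first x n" "vec_last x q"] bound[of "vec_first x n" "vec_last x q"] x(2) by simp
  qed
  have e': "unit_vec n 0 @\<^sub>v Zb *\<^sub>v unit_vec n 0 \<in> carrier_vec ?d" using Zb by simp
  obtain \<alpha> where \<alpha>: "\<alpha> \<ge> 0" "\<And>x. x \<in> carrier_vec ?d \<Longrightarrow> \<alpha> * bf N x x \<le> bf (M - E) x x"
    using S_lemma[OF ME N e' pos[OF e] ME_nonneg] by blast
  show ?thesis
  proof (rule that[OF \<alpha>(1) \<epsilon>(1)])
    fix x1 x2 :: "real vec" assume x: "x1 \<in> carrier_vec n" "x2 \<in> carrier_vec q"
    then show "\<alpha> * bf N (x1 @\<^sub>v x2) (x1 @\<^sub>v x2) + \<epsilon> * (x1 \<bullet> x1) \<le> bf M (x1 @\<^sub>v x2) (x1 @\<^sub>v x2)"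
      using \<alpha>(2)[of "x1 @\<^sub>v x2"] bfE[OF x] by simp
  qed
qed

section \<open>Block matrices\<close>

lemma transpose_append_rows_mult_vec:
  fixes A B :: "real mat"
  assumes "A \<in> carrier_mat a c" "B \<in> carrier_mat b c" "y \<in> carrier_vec a" "z \<in> carrier_vec b"
  shows "(A @\<^sub>r B)\<^sup>T *\<^sub>v (y @\<^sub>v z) = A\<^sup>T *\<^sub>v y + B\<^sup>T *\<^sub>v z"
proof -
  \<comment> \<open>Stacking rows is a block matrix with an empty right column, so its transpose has
    lower blocks without rows.\<close>
  have "(A @\<^sub>r B)\<^sup>T = four_block_mat A\<^sup>T B\<^sup>T (0\<^sub>m 0 a) (0\<^sub>m 0 b)"
    unfolding append_rows_def using assms by (subst transpose_four_block_mat[of _ a c _ 0 _ b]) auto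
  moreover have "four_block_mat A\<^sup>T B\<^sup>T (0\<^sub>m 0 a) (0\<^sub>m 0 b) *\<^sub>v (y @\<^sub>v z) =
      (A\<^sup>T *\<^sub>v y + B\<^sup>T *\<^sub>v z) @\<^sub>v (0\<^sub>m 0 a *\<^sub>v y + 0\<^sub>m 0 b *\<^sub>v z)"
    by (rule four_block_mat_mult_vec) (use assms in auto)
  ultimately show ?thesis using assms by (auto intro!: eq_vecI)
qed

lemma transpose_four_block_mult_vec:
  fixes X D :: "real mat"
  assumes "X \<in> carrier_mat n T" "D \<in> carrier_mat k T" "x \<in> carrier_vec n" "y \<in> carrier_vec k"
  shows "(four_block_mat (1\<^sub>m n) X (0\<^sub>m k n) D)\<^sup>T *\<^sub>v (x @\<^sub>v y) = x @\<^sub>v (X\<^sup>T *\<^sub>v x + D\<^sup>T *\<^sub>v y)"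
proof -
  have "(four_block_mat (1\<^sub>m n) X (0\<^sub>m k n) D)\<^sup>T = four_block_mat (1\<^sub>m n) (0\<^sub>m n k) X\<^sup>T D\<^sup>T"
    using assms by (subst transpose_four_block_mat[of _ n n _ T _ k]) auto
  also have "\<dots> *\<^sub>v (x @\<^sub>v y) = (1\<^sub>m n *\<^sub>v x + 0\<^sub>m n k *\<^sub>v y) @\<^sub>v (X\<^sup>T *\<^sub>v x + D\<^sup>T *\<^sub>v y)"
    by (rule four_block_mat_mult_vec) (use assms in auto)
  also have "1\<^sub>m n *\<^sub>v x + 0\<^sub>m n k *\<^sub>v y = x" using assms by (auto intro!: eq_vecI)
  finally show ?thesis .
qed

lemma bf_congruence:
  assumes "S \<in> carrier_mat k l" "F \<in> carrier_mat l l" "v \<in> carrier_vec k"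
  shows "bf (S * F * S\<^sup>T) v v = bf F (S\<^sup>T *\<^sub>v v) (S\<^sup>T *\<^sub>v v)"
proof -
  have "(S * F * S\<^sup>T) *\<^sub>v v = S *\<^sub>v (F *\<^sub>v (S\<^sup>T *\<^sub>v v))"
    using assms by (simp add: assoc_mult_mat_vec[of _ k l _ k] assoc_mult_mat_vec[of _ k l _ l])
  then show ?thesis
    unfolding bf_def using assms transpose_vec_mult_scalar[OF assms(1), of "F *\<^sub>v (S\<^sup>T *\<^sub>v v)" v] by simp
qed

lemma congruence_sym:
  fixes S F :: "real mat"
  assumes "S \<in> carrier_mat k l" "F \<in> carrier_mat l l" "F\<^sup>T = F"
  shows "S * F * S\<^sup>T \<in> carrier_mat k k" "(S * F * S\<^sup>T)\<^sup>T = S * F * S\<^sup>T"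
proof -
  have "(S * F * S\<^sup>T)\<^sup>T = S * (S * F)\<^sup>T"
    using assms by (subst transpose_mult[of _ k l _ k]) auto
  also have "\<dots> = S * (F * S\<^sup>T)" using assms by (subst transpose_mult[of _ k l _ l]) auto
  also have "\<dots> = S * F * S\<^sup>T" using assms by (subst assoc_mult_mat[of _ k l _ l _ k]) auto
  finally show "(S * F * S\<^sup>T)\<^sup>T = S * F * S\<^sup>T" .
qed (use assms in simp)

lemma pd_mat_bf: "pd_mat k A \<longleftrightarrow> A \<in> carrier_mat k k \<and> A\<^sup>T = A \<and>
    (\<forall>v\<in>carrier_vec k. v \<noteq> 0\<^sub>v k \<longrightarrow> 0 < bf A v v)"
  unfolding pd_mat_def bf_def ..

lemma psd_mat_bf: "psd_mat k A \<longleftrightarrow> A \<in> carrier_mat k k \<and> A\<^sup>T = A \<and>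
    (\<forall>v\<in>carrier_vec k. 0 \<le> bf A v v)"
  unfolding psd_mat_def bf_def ..

lemma pd_mat_nonneg:
  assumes "pd_mat k A" "v \<in> carrier_vec k"
  shows "0 \<le> bf A v v"
proof (cases "v = 0\<^sub>v k")
  case True
  then show ?thesis using assms(1) unfolding bf_def pd_mat_def
    by (metis mult_mat_vec_carrier order.refl scalar_prod_left_zero zero_carrier_vec)
next
  case False
  then show ?thesis using assms by (simp add: pd_mat_bf less_imp_le)
qed

lemma bf_minus:
  assumes "A \<in> carrier_mat d d" "B \<in> carrier_mat d d" "v \<in> carrier_vec d"
  shows "bf (A - B) v v = bf A v v - bf B v v"
  using assms unfolding bf_def
  by (simp add: minus_mult_distrib_mat_vec[of _ d d] scalar_prod_minus_distrib[of _ d])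

lemma bf_smult_mat:
  assumes "A \<in> carrier_mat d d" "v \<in> carrier_vec d"
  shows "bf (c \<cdot>\<^sub>m A) v v = c * bf A v v"
  using assms unfolding bf_def by (simp add: smult_mat_mult_vec[of _ d d])

lemma bf_uminus:
  assumes "A \<in> carrier_mat d d" "v \<in> carrier_vec d"
  shows "bf (- A) v v = - bf A v v"
  using assms unfolding bf_def by simp

lemma append_vec_assoc:
  "(a @\<^sub>v b) @\<^sub>v c = a @\<^sub>v (b @\<^sub>v (c :: 'a vec))"
  by (intro eq_vecI) (simp_all add: less_diff_conv2)

lemma vec_split:
  assumes "v \<in> carrier_vec (a + b)"
  obtains x y where "x \<in> carrier_vec a" "y \<in> carrier_vec b" "v = x @\<^sub>v y"
  using assms vec_first_last_append by (metis vec_first_carrier vec_last_carrier)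

text \<open>A nonzero kernel vector would give the form the value 0. Hence
  \<open>mat_inverse P\<close> is a \<open>Some\<close>, and \<open>the\<close> extracts a genuine
  inverse.\<close>

lemma pd_mat_inverse:
  assumes "pd_mat k P"
  shows "the (mat_inverse P) \<in> carrier_mat k k" "the (mat_inverse P) * P = 1\<^sub>m k"
proof -
  have P: "P \<in> carrier_mat k k" using assms by (simp add: pd_mat_def)
  have "det P \<noteq> 0"
    using assms by (auto simp: det_0_iff_vec_prod_zero_field[OF P] pd_mat_def)
  then have "P \<in> Units (ring_mat TYPE(real) k ())" by (rule det_non_zero_imp_unit[OF P])
  then obtain B where "mat_inverse P = Some B" using mat_inverse(1)[OF P, where b = "()"]
    by (cases "mat_inverse P") simp_all
  then show "the (mat_inverse P) \<in> carrier_mat k k" "the (mat_inverse P) * P = 1\<^sub>m k"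
    using mat_inverse(2)[OF P] by auto
qed

section \<open>The LMI block matrix and its quadratic form\<close>

lemma LMI_block_carrier:
  assumes "P \<in> carrier_mat n n" "L \<in> carrier_mat m n"
  shows "LMI_block n m P L \<beta> \<in> carrier_mat ((n + n) + (m + n)) ((n + n) + (m + n))"
  using assms unfolding LMI_block_def by (intro four_block_carrier_mat) auto

lemma LMI_block_sym:
  assumes "P \<in> carrier_mat n n" "P\<^sup>T = P" "L \<in> carrier_mat m n"
  shows "(LMI_block n m P L \<beta>)\<^sup>T = LMI_block n m P L \<beta>"
proof -
  have "(P - \<beta> \<cdot>\<^sub>m 1\<^sub>m n)\<^sup>T = P - \<beta> \<cdot>\<^sub>m 1\<^sub>m n"
    using assms by (simp add: transpose_minus[of _ n n] transpose_smult)
  then have "(four_block_mat (P - \<beta> \<cdot>\<^sub>m 1\<^sub>m n) (0\<^sub>m n n) (0\<^sub>m n n) (- P))\<^sup>T =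
      four_block_mat (P - \<beta> \<cdot>\<^sub>m 1\<^sub>m n) (0\<^sub>m n n) (0\<^sub>m n n) (- P)"
    using assms by (subst transpose_four_block_mat[of _ n n _ n _ n]) (auto simp: transpose_uminus)
  moreover have "(four_block_mat (0\<^sub>m n m) (0\<^sub>m n n) (- L\<^sup>T) (0\<^sub>m n n))\<^sup>T =
      four_block_mat (0\<^sub>m m n) (- L) (0\<^sub>m n n) (0\<^sub>m n n)"
    using assms by (subst transpose_four_block_mat[of _ n m _ n _ n]) (auto simp: transpose_uminus)
  moreover from this have "(four_block_mat (0\<^sub>m m n) (- L) (0\<^sub>m n n) (0\<^sub>m n n))\<^sup>T =
      four_block_mat (0\<^sub>m n m) (0\<^sub>m n n) (- L\<^sup>T) (0\<^sub>m n n)"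
    by (metis transpose_transpose)
  moreover have "(four_block_mat (0\<^sub>m m m) L L\<^sup>T P)\<^sup>T = four_block_mat (0\<^sub>m m m) L L\<^sup>T P"
    using assms by (subst transpose_four_block_mat[of _ m m _ n _ n]) auto
  ultimately show ?thesis
    using assms unfolding LMI_block_def
    by (subst transpose_four_block_mat[of _ "n + n" "n + n" _ "m + n" _ "m + n"])
      (auto intro!: four_block_carrier_mat)
qed

lemma bf_LMI_block:
  assumes P: "P \<in> carrier_mat n n" and L: "L \<in> carrier_mat m n"
    and v: "x \<in> carrier_vec n" "y \<in> carrier_vec n" "z \<in> carrier_vec m" "w \<in> carrier_vec n"
  shows "bf (LMI_block n m P L \<beta>) ((x @\<^sub>v y) @\<^sub>v (z @\<^sub>v w)) (( x @\<^sub>v y) @\<^sub>v (z @\<^sub>v w)) =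
    bf P x x - \<beta> * (x \<bullet> x) - bf P y y - 2 * (y \<bullet> (L\<^sup>T *\<^sub>v z)) + 2 * (w \<bullet> (L\<^sup>T *\<^sub>v z)) + bf P w w"
proof -
  have "LMI_block n m P L \<beta> *\<^sub>v ((x @\<^sub>v y) @\<^sub>v (z @\<^sub>v w)) =
    ((P *\<^sub>v x - \<beta> \<cdot>\<^sub>v x) @\<^sub>v (- (P *\<^sub>v y) + - (L\<^sup>T *\<^sub>v z))) @\<^sub>v
    ((- (L *\<^sub>v y) + L *\<^sub>v w) @\<^sub>v (L\<^sup>T *\<^sub>v z + P *\<^sub>v w))"
  proof -
    have tl: "four_block_mat (P - \<beta> \<cdot>\<^sub>m 1\<^sub>m n) (0\<^sub>m n n) (0\<^sub>m n n) (- P) *\<^sub>v (x @\<^sub>v y) =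
        (P *\<^sub>v x - \<beta> \<cdot>\<^sub>v x) @\<^sub>v - (P *\<^sub>v y)"
      using assms by (subst mult_mat_vec_split[of _ n _ n])
        (auto simp: minus_mult_distrib_mat_vec[of _ n n] smult_mat_mult_vec[of _ n n])
    have tr: "four_block_mat (0\<^sub>m n m) (0\<^sub>m n n) (- L\<^sup>T) (0\<^sub>m n n) *\<^sub>v (z @\<^sub>v w) =
        0\<^sub>v n @\<^sub>v - (L\<^sup>T *\<^sub>v z)"
      using assms by (subst four_block_mat_mult_vec[of _ n m _ n _ n])
        (auto intro!: arg_cong2[of _ _ _ _ append_vec] eq_vecI)
    have bl: "four_block_mat (0\<^sub>m m n) (- L) (0\<^sub>m n n) (0\<^sub>m n n) *\<^sub>v (x @\<^sub>v y) =
        - (L *\<^sub>v y) @\<^sub>v 0\<^sub>v n"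
      using assms by (subst four_block_mat_mult_vec[of _ m n _ n _ n])
        (auto intro!: arg_cong2[of _ _ _ _ append_vec] eq_vecI)
    have br: "four_block_mat (0\<^sub>m m m) L L\<^sup>T P *\<^sub>v (z @\<^sub>v w) =
        (L *\<^sub>v w) @\<^sub>v (L\<^sup>T *\<^sub>v z + P *\<^sub>v w)"
      using assms by (subst four_block_mat_mult_vec[of _ m m _ n _ n])
        (auto intro!: arg_cong2[of _ _ _ _ append_vec] eq_vecI)
    show ?thesis
      unfolding LMI_block_def
      by (subst four_block_mat_mult_vec[of _ "n + n" "n + n" _ "m + n" _ "m + n"])
        (use assms in \<open>auto simp: tl tr bl br simp flip: append_vec_add[of _ n _ _ n]
          append_vec_add[of _ m _ _ n] intro!: four_block_carrier_mat\<close>)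
  qed
  moreover have "z \<bullet> (L *\<^sub>v y) = y \<bullet> (L\<^sup>T *\<^sub>v z)" if "y \<in> carrier_vec n" for y
    using transpose_vec_mult_scalar[OF L that v(3)] that L v(3)
    by (metis comm_scalar_prod mult_mat_vec_carrier transpose_carrier_mat)
  ultimately show ?thesis
    unfolding bf_def using assms
    by (simp add: scalar_prod_append[of _ "n + n" _ "m + n"] scalar_prod_append[of _ n _ n]
        scalar_prod_append[of _ m _ n] scalar_prod_add_distrib[of _ n] scalar_prod_add_distrib[of _ m]
        scalar_prod_minus_distrib[of _ n])
qed

text \<open>With L = K P the mixed terms are \<open>P\<close>-inner products with k =
  \<open>K\<^sup>T *\<^sub>v z\<close>. Completing the squares in y and w needs the
  \<open>P\<close>-form of k once with each sign, and the two copies cancel.\<close>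

lemma bf_LMI_block_complete_square:
  assumes P: "P \<in> carrier_mat n n" "P\<^sup>T = P" and K: "K \<in> carrier_mat m n"
    and v: "x \<in> carrier_vec n" "y \<in> carrier_vec n" "z \<in> carrier_vec m" "w \<in> carrier_vec n"
  shows "bf (LMI_block n m P (K * P) \<beta>) ((x @\<^sub>v y) @\<^sub>v (z @\<^sub>v w)) (( x @\<^sub>v y) @\<^sub>v (z @\<^sub>v w)) =
    bf P x x - \<beta> * (x \<bullet> x) - bf P (y + K\<^sup>T *\<^sub>v z) (y + K\<^sup>T *\<^sub>v z)
      + bf P (w + K\<^sup>T *\<^sub>v z) (w + K\<^sup>T *\<^sub>v z)"
proof -
  let ?k = "K\<^sup>T *\<^sub>v z"
  have k: "?k \<in> carrier_vec n" using K v by simp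
  have KP: "K * P \<in> carrier_mat m n" using K P by simp
  have "(K * P)\<^sup>T *\<^sub>v z = P *\<^sub>v ?k"
    using K P v by (simp add: transpose_mult[of _ m n _ n] assoc_mult_mat_vec[of _ n n _ m])
  moreover have "bf P (u + ?k) (u + ?k) = bf P u u + 2 * bf P u ?k + bf P ?k ?k" if "u \<in> carrier_vec n" for u
    using bf_expand[OF P that k, of 1] by simp
  ultimately show ?thesis using bf_LMI_block[OF P(1) KP v] v unfolding bf_def by simp
qed

section \<open>Lyapunov inequality and Schur stability\<close>

text \<open>For a left eigenvector a + i b of C with eigenvalue z, the real Lyapunov forms at a and
  b add up to (1 - |z|^2) (P(a) + P(b)). The sum is positive and the second factor nonnegative, so
  |z| < 1.\<close>

lemma schur_stable_lyapunov:
  assumes P: "pd_mat n P" and C: "C \<in> carrier_mat n n"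
    and lyap: "pd_mat n (P - C * P * C\<^sup>T)"
  shows "schur_stable C"
  unfolding schur_stable_def
proof (intro allI impI)
  fix z assume ev: "eigenvalue (map_mat complex_of_real C) z"
  let ?C = "map_mat complex_of_real C"
  have Cc: "?C \<in> carrier_mat n n" using C by simp
  \<comment> \<open>The Lyapunov form at v involves the transpose of C applied to v, so an
    eigenvector of the transpose is wanted; both matrices have the same characteristic
    polynomial.\<close>
  have "eigenvalue ?C\<^sup>T z"
    using ev Cc by (simp add: eigenvalue_root_char_poly[of _ n] char_poly_transpose_mat[of _ n])
  then obtain u where u: "u \<in> carrier_vec n" "u \<noteq> 0\<^sub>v n" "?C\<^sup>T *\<^sub>v u = z \<cdot>\<^sub>v u"
    unfolding eigenvalue_def eigenvector_def using C by auto
  define a b where "a = map_vec Re u" and "b = map_vec Im u"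
  have ab: "a \<in> carrier_vec n" "b \<in> carrier_vec n" unfolding a_def b_def using u by auto
  have Cu: "(\<Sum>j\<in>{0..<n}. complex_of_real (C $$ (j, i)) * u $ j) = z * u $ i" if "i < n" for i
    using arg_cong[OF u(3), of "\<lambda>v. v $ i"] that C u(1)
    by (simp add: scalar_prod_def)
  have CuRe: "(\<Sum>j\<in>{0..<n}. C $$ (j, i) * Re (u $ j)) = Re z * Re (u $ i) - Im z * Im (u $ i)" if "i < n" for i
    using arg_cong[OF Cu[OF that], of Re] by simp
  have CuIm: "(\<Sum>j\<in>{0..<n}. C $$ (j, i) * Im (u $ j)) = Re z * Im (u $ i) + Im z * Re (u $ i)" if "i < n" for i
    using arg_cong[OF Cu[OF that], of Im] by simp
  \<comment> \<open>On the real span of a and b the transpose acts as a rotation scaled by |z|, so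
    the mixed terms cancel when the forms at a and b are added.\<close>
  have Ca: "C\<^sup>T *\<^sub>v a = Re z \<cdot>\<^sub>v a + (- Im z) \<cdot>\<^sub>v b"
    by (intro eq_vecI) (use CuRe C u(1) in \<open>auto simp: scalar_prod_def a_def b_def\<close>)
  have Cb: "C\<^sup>T *\<^sub>v b = Im z \<cdot>\<^sub>v a + Re z \<cdot>\<^sub>v b"
    by (intro eq_vecI) (use CuIm C u(1) in \<open>auto simp: scalar_prod_def a_def b_def\<close>)
  have Pc: "P \<in> carrier_mat n n" "P\<^sup>T = P" using P by (auto simp: pd_mat_def)
  have comb: "bf P (s \<cdot>\<^sub>v a + t \<cdot>\<^sub>v b) (s \<cdot>\<^sub>v a + t \<cdot>\<^sub>v b) = s\<^sup>2 * bf P a a + 2 * s * t * bf P a b + t\<^sup>2 * bf P b b" for s t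
    using bf_expand[OF Pc, of "s \<cdot>\<^sub>v a" b t] ab Pc by (simp add: bf_smult[of _ n]) (simp add: bf_def)
  have CPC: "C * P * C\<^sup>T \<in> carrier_mat n n" using C Pc by simp
  have low: "bf (P - C * P * C\<^sup>T) v v = bf P v v - bf P (C\<^sup>T *\<^sub>v v) (C\<^sup>T *\<^sub>v v)" if "v \<in> carrier_vec n" for v
    using that by (simp add: bf_minus[OF Pc(1) CPC] bf_congruence[OF C Pc(1)])
  have "a \<noteq> 0\<^sub>v n \<or> b \<noteq> 0\<^sub>v n"
  proof (rule ccontr)
    assume "\<not> ?thesis"
    then have "u $ i = 0" if "i < n" for i
      using that u(1) unfolding a_def b_def by (auto simp: vec_eq_iff complex_eq_iff)
    then have "u = 0\<^sub>v n" using u(1) by (intro eq_vecI) auto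
    then show False using u(2) by simp
  qed
  then have "0 < bf (P - C * P * C\<^sup>T) a a + bf (P - C * P * C\<^sup>T) b b"
    using lyap pd_mat_nonneg[OF lyap] ab unfolding pd_mat_bf by (metis add_pos_nonneg add_nonneg_pos)
  also have "\<dots> = (1 - (cmod z)\<^sup>2) * (bf P a a + bf P b b)"
    unfolding low[OF ab(1)] low[OF ab(2)] Ca Cb comb cmod_power2
    by (simp add: power2_eq_square algebra_simps)
  finally have "0 < (1 - (cmod z)\<^sup>2) * (bf P a a + bf P b b)" .
  moreover have "0 \<le> bf P a a + bf P b b" using pd_mat_nonneg[OF P] ab by simp
  ultimately have "(cmod z)\<^sup>2 < 1" by (simp add: zero_less_mult_iff)
  then show "cmod z < 1" using power2_less_imp_less[of "cmod z" 1] by simp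
qed

section \<open>The data-driven LMI\<close>

locale noisy_data =
  fixes n m T :: nat and Xp Xm Um P11 P12 P22 :: "real mat"
  assumes Xp: "Xp \<in> carrier_mat n T" and Xm: "Xm \<in> carrier_mat n T" and Um: "Um \<in> carrier_mat m T"
    and P11: "P11 \<in> carrier_mat n n" and P11_sym: "P11\<^sup>T = P11"
    and P12: "P12 \<in> carrier_mat n T"
    and P22: "P22 \<in> carrier_mat T T" and P22_neg: "pd_mat T (- P22)"
begin

abbreviation "Phi \<equiv> Phi_mat P11 P12 P22"
abbreviation "N \<equiv> N_mat n m Xp Xm Um P11 P12 P22"
abbreviation "N4 \<equiv> N4_mat n m T Xp Xm Um P11 P12 P22"
abbreviation "Sig \<equiv> Sigma_set n m T Xp Xm Um P11 P12 P22"

text \<open>The argument at which \<open>Phi\<close> is evaluated by the form of N. For y and z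
  obtained from x by the transposes of A and B, its second part is the transposed noise matrix
  applied to x.\<close>

definition residual :: "real vec \<Rightarrow> real vec \<Rightarrow> real vec \<Rightarrow> real vec" where
  "residual x y z = x @\<^sub>v (Xp\<^sup>T *\<^sub>v x - (Xm\<^sup>T *\<^sub>v y + Um\<^sup>T *\<^sub>v z))"

lemma P22_sym: "P22\<^sup>T = P22"
  using P22_neg unfolding pd_mat_def transpose_uminus by (metis uminus_uminus_mat)

lemma Phi: "Phi \<in> carrier_mat (n + T) (n + T)" "Phi\<^sup>T = Phi"
  using P11 P11_sym P12 P22 P22_sym unfolding Phi_mat_def
  by (auto intro!: four_block_carrier_mat simp: transpose_four_block_mat[of _ n n _ T _ T])

text \<open>Writes N as a congruence of \<open>Phi\<close>, so that its form can be computed from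
  \<open>residual\<close> without handling the blocks of S again.\<close>

lemma N_factor:
  obtains S where "S \<in> carrier_mat (n + (n + m)) (n + T)" "N = S * Phi * S\<^sup>T"
    "\<And>x y z. x \<in> carrier_vec n \<Longrightarrow> y \<in> carrier_vec n \<Longrightarrow> z \<in> carrier_vec m \<Longrightarrow>
      S\<^sup>T *\<^sub>v (x @\<^sub>v (y @\<^sub>v z)) = residual x y z"
proof
  define D where "D = (- Xm) @\<^sub>r (- Um)"
  have D: "D \<in> carrier_mat (n + m) T" unfolding D_def using Xm Um by (intro carrier_append_rows) auto
  define S where "S = four_block_mat (1\<^sub>m n) Xp (0\<^sub>m (n + m) n) D"
  show "S \<in> carrier_mat (n + (n + m)) (n + T)" unfolding S_def using Xp D by (intro four_block_carrier_mat) auto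
  show "N = S * Phi * S\<^sup>T" unfolding N_mat_def S_def D_def Let_def ..
  fix x y z :: "real vec" assume v: "x \<in> carrier_vec n" "y \<in> carrier_vec n" "z \<in> carrier_vec m"
  have "D\<^sup>T *\<^sub>v (y @\<^sub>v z) = - (Xm\<^sup>T *\<^sub>v y) + - (Um\<^sup>T *\<^sub>v z)"
    unfolding D_def using Xm Um v
    by (simp add: transpose_append_rows_mult_vec[of _ n T _ m] transpose_uminus)
  then show "S\<^sup>T *\<^sub>v (x @\<^sub>v (y @\<^sub>v z)) = residual x y z"
    unfolding S_def residual_def using Xp Xm Um D v
    by (auto simp: transpose_four_block_mult_vec[of _ n T _ "n + m"] intro!: arg_cong2[of _ _ _ _ append_vec] eq_vecI)
qed

text \<open>The last block row of the outer factor is zero, so w drops out and the form agrees with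
  that of N. The grouping (n + n) + (m + n) follows the nesting in \<open>LMI_block\<close>.\<close>

lemma N4_factor:
  obtains S where "S \<in> carrier_mat ((n + n) + (m + n)) (n + T)" "N4 = S * Phi * S\<^sup>T"
    "\<And>x y z w. x \<in> carrier_vec n \<Longrightarrow> y \<in> carrier_vec n \<Longrightarrow> z \<in> carrier_vec m \<Longrightarrow> w \<in> carrier_vec n \<Longrightarrow>
      S\<^sup>T *\<^sub>v ((x @\<^sub>v y) @\<^sub>v (z @\<^sub>v w)) = residual x y z"
proof
  define D where "D = (- Xm) @\<^sub>r (- Um) @\<^sub>r 0\<^sub>m n T"
  have U: "(- Um) @\<^sub>r 0\<^sub>m n T \<in> carrier_mat (m + n) T" using Um by (intro carrier_append_rows) auto
  have D: "D \<in> carrier_mat (n + (m + n)) T"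
    unfolding D_def using Xm U by (intro carrier_append_rows[OF _ U]) simp
  define S where "S = four_block_mat (1\<^sub>m n) Xp (0\<^sub>m (n + (m + n)) n) D"
  have idx: "n + n + m = n + (m + n)" by simp
  have "S \<in> carrier_mat (n + (n + (m + n))) (n + T)"
    unfolding S_def using Xp D by (intro four_block_carrier_mat) auto
  then show "S \<in> carrier_mat ((n + n) + (m + n)) (n + T)" by (simp add: add.assoc)
  show "N4 = S * Phi * S\<^sup>T" unfolding N4_mat_def S_def D_def Let_def idx ..
  fix x y z w :: "real vec"
  assume v: "x \<in> carrier_vec n" "y \<in> carrier_vec n" "z \<in> carrier_vec m" "w \<in> carrier_vec n"
  have "D\<^sup>T *\<^sub>v (y @\<^sub>v (z @\<^sub>v w)) = - (Xm\<^sup>T *\<^sub>v y) + (- (Um\<^sup>T *\<^sub>v z) + 0\<^sub>v T)"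
    unfolding D_def using Xm Um U v
    by (simp add: transpose_append_rows_mult_vec[of _ n T _ "m + n"] transpose_append_rows_mult_vec[of _ m T _ n]
        transpose_uminus) (auto intro!: eq_vecI)
  then show "S\<^sup>T *\<^sub>v ((x @\<^sub>v y) @\<^sub>v (z @\<^sub>v w)) = residual x y z"
    unfolding S_def residual_def append_vec_assoc using Xp Xm Um D v
    by (auto simp: transpose_four_block_mult_vec[of _ n T _ "n + (m + n)"]
        intro!: arg_cong2[of _ _ _ _ append_vec] eq_vecI)
qed

lemma N: "N \<in> carrier_mat (n + (n + m)) (n + (n + m))" "N\<^sup>T = N"
  using N_factor congruence_sym[OF _ Phi] by metis+

lemma N4: "N4 \<in> carrier_mat ((n + n) + (m + n)) ((n + n) + (m + n))" "N4\<^sup>T = N4"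
  using N4_factor congruence_sym[OF _ Phi] by metis+

lemma bf_N:
  assumes "x \<in> carrier_vec n" "y \<in> carrier_vec n" "z \<in> carrier_vec m"
  shows "bf N (x @\<^sub>v (y @\<^sub>v z)) (x @\<^sub>v (y @\<^sub>v z)) = bf Phi (residual x y z) (residual x y z)"
  using assms N_factor bf_congruence[OF _ Phi(1)] append_carrier_vec by metis

lemma bf_N4:
  assumes "x \<in> carrier_vec n" "y \<in> carrier_vec n" "z \<in> carrier_vec m" "w \<in> carrier_vec n"
  shows "bf N4 ((x @\<^sub>v y) @\<^sub>v (z @\<^sub>v w)) ((x @\<^sub>v y) @\<^sub>v (z @\<^sub>v w)) = bf N (x @\<^sub>v (y @\<^sub>v z)) (x @\<^sub>v (y @\<^sub>v z))"
proof -
  obtain S where S: "S \<in> carrier_mat ((n + n) + (m + n)) (n + T)" "N4 = S * Phi * S\<^sup>T"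
    "S\<^sup>T *\<^sub>v ((x @\<^sub>v y) @\<^sub>v (z @\<^sub>v w)) = residual x y z"
    using N4_factor assms by metis
  have "(x @\<^sub>v y) @\<^sub>v (z @\<^sub>v w) \<in> carrier_vec ((n + n) + (m + n))" using assms by (intro append_carrier_vec)
  from bf_congruence[OF S(1) Phi(1) this] show ?thesis unfolding bf_N[OF assms(1-3)] S(2,3) .
qed

lemma bf_Phi_noise:
  assumes "b \<in> carrier_vec T"
  shows "bf Phi (0\<^sub>v n @\<^sub>v b) (0\<^sub>v n @\<^sub>v b) = bf P22 b b"
proof -
  have "Phi *\<^sub>v (0\<^sub>v n @\<^sub>v b) = (P11 *\<^sub>v 0\<^sub>v n + P12 *\<^sub>v b) @\<^sub>v (P12\<^sup>T *\<^sub>v 0\<^sub>v n + P22 *\<^sub>v b)"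
    unfolding Phi_mat_def by (rule four_block_mat_mult_vec) (use P11 P12 P22 assms in auto)
  also have "P12\<^sup>T *\<^sub>v 0\<^sub>v n + P22 *\<^sub>v b = P22 *\<^sub>v b"
    using P12 P22 assms by (auto intro!: eq_vecI simp: scalar_prod_def)
  finally show ?thesis
    unfolding bf_def using P11 P12 P22 assms by (simp add: scalar_prod_append[of _ n _ T])
qed

text \<open>On the lower block the residual is (0, b), where only the negative definite
  \<open>P22\<close> acts. A vanishing form therefore forces b = 0; then the innermost factor of N
  already annihilates the vector.\<close>

lemma N_kernel:
  assumes w: "w \<in> carrier_vec (n + m)"
  shows "bf N (0\<^sub>v n @\<^sub>v w) (0\<^sub>v n @\<^sub>v w) \<le> 0"
    and "bf N (0\<^sub>v n @\<^sub>v w) (0\<^sub>v n @\<^sub>v w) = 0 \<Longrightarrow> N *\<^sub>v (0\<^sub>v n @\<^sub>v w) = 0\<^sub>v (n + (n + m))"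
proof -
  obtain y z where yz: "y \<in> carrier_vec n" "z \<in> carrier_vec m" "w = y @\<^sub>v z" using vec_split[OF w] .
  define b where "b = Xp\<^sup>T *\<^sub>v 0\<^sub>v n - (Xm\<^sup>T *\<^sub>v y + Um\<^sup>T *\<^sub>v z)"
  have b: "b \<in> carrier_vec T" unfolding b_def using Xp Xm Um yz by simp
  have res: "residual (0\<^sub>v n) y z = 0\<^sub>v n @\<^sub>v b" unfolding residual_def b_def ..
  have form: "bf N (0\<^sub>v n @\<^sub>v w) (0\<^sub>v n @\<^sub>v w) = - bf (- P22) b b"
    unfolding yz(3) using yz bf_uminus[OF P22 b] bf_Phi_noise[OF b] by (simp add: bf_N res)
  show "bf N (0\<^sub>v n @\<^sub>v w) (0\<^sub>v n @\<^sub>v w) \<le> 0" unfolding form using pd_mat_nonneg[OF P22_neg b] by simp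
  assume "bf N (0\<^sub>v n @\<^sub>v w) (0\<^sub>v n @\<^sub>v w) = 0"
  then have "b = 0\<^sub>v T" using P22_neg b unfolding form pd_mat_bf by fastforce
  then have r0: "residual (0\<^sub>v n) y z = 0\<^sub>v (n + T)" unfolding res by (auto intro!: eq_vecI)
  obtain S where S: "S \<in> carrier_mat (n + (n + m)) (n + T)" "N = S * Phi * S\<^sup>T"
    "S\<^sup>T *\<^sub>v (0\<^sub>v n @\<^sub>v w) = residual (0\<^sub>v n) y z"
    using N_factor yz zero_carrier_vec by metis
  have "0\<^sub>v n @\<^sub>v w \<in> carrier_vec (n + (n + m))" using w by simp
  then have "N *\<^sub>v (0\<^sub>v n @\<^sub>v w) = (S * Phi) *\<^sub>v (S\<^sup>T *\<^sub>v (0\<^sub>v n @\<^sub>v w))"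
    unfolding S(2) using S(1) Phi(1) by (intro assoc_mult_mat_vec[of _ _ "n + T"]) auto
  then show "N *\<^sub>v (0\<^sub>v n @\<^sub>v w) = 0\<^sub>v (n + (n + m))"
    unfolding S(3) r0 using S(1) Phi(1) by (auto intro!: eq_vecI simp: scalar_prod_def)
qed

lemma noise_ok_iff:
  assumes W: "W \<in> carrier_mat n T"
  shows "noise_ok n P11 P12 P22 W \<longleftrightarrow>
    (\<forall>v\<in>carrier_vec n. 0 \<le> bf Phi (v @\<^sub>v W\<^sup>T *\<^sub>v v) (v @\<^sub>v W\<^sup>T *\<^sub>v v))"
proof -
  define E where "E = (1\<^sub>m n @\<^sub>r W\<^sup>T)\<^sup>T"
  have Wt: "W\<^sup>T \<in> carrier_mat T n" using W by simp
  have E: "E \<in> carrier_mat n (n + T)" unfolding E_def using carrier_append_rows[OF _ Wt, of "1\<^sub>m n" n] by simp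
  have "E\<^sup>T *\<^sub>v v = v @\<^sub>v W\<^sup>T *\<^sub>v v" if "v \<in> carrier_vec n" for v
    unfolding E_def using mat_mult_append[OF _ Wt that, of "1\<^sub>m n" n] that by simp
  then have "bf (E * Phi * E\<^sup>T) v v = bf Phi (v @\<^sub>v W\<^sup>T *\<^sub>v v) (v @\<^sub>v W\<^sup>T *\<^sub>v v)" if "v \<in> carrier_vec n" for v
    using bf_congruence[OF E Phi(1) that] that by simp
  moreover have "noise_ok n P11 P12 P22 W \<longleftrightarrow> psd_mat n (E * Phi * E\<^sup>T)"
    unfolding noise_ok_def E_def by simp
  ultimately show ?thesis using congruence_sym[OF E Phi] by (simp add: psd_mat_bf)
qed

text \<open>The data determine the noise for given A and B, namely W = Xp - (A Xm + B Um). The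
  residual on the graph of the stacked transposes is (v, \<open>W\<^sup>T *\<^sub>v v\<close>),
  which turns the noise inequality into one about N.\<close>

lemma Sigma_iff:
  assumes A: "A \<in> carrier_mat n n" and B: "B \<in> carrier_mat n m"
  shows "(A, B) \<in> Sig \<longleftrightarrow> (\<forall>v\<in>carrier_vec n.
    0 \<le> bf N (v @\<^sub>v (A\<^sup>T *\<^sub>v v @\<^sub>v B\<^sup>T *\<^sub>v v)) (v @\<^sub>v (A\<^sup>T *\<^sub>v v @\<^sub>v B\<^sup>T *\<^sub>v v)))"
proof -
  define W where "W = Xp - (A * Xm + B * Um)"
  have W: "W \<in> carrier_mat n T" unfolding W_def using Xp A Xm B Um by auto
  have AX: "A * Xm \<in> carrier_mat n T" "B * Um \<in> carrier_mat n T" using A Xm B Um by auto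
  have sub: "Y + Z + V - (Y + Z) = V" and add_sub: "Y + Z + (V - (Y + Z)) = V"
    if "Y \<in> carrier_mat n T" "Z \<in> carrier_mat n T" "V \<in> carrier_mat n T" for Y Z V :: "real mat"
    using that by (auto intro!: eq_matI)
  have "W' = W" if "W' \<in> carrier_mat n T" "Xp = A * Xm + B * Um + W'" for W'
    unfolding W_def that(2) using sub[OF AX that(1)] by simp
  moreover have "Xp = A * Xm + B * Um + W"
    unfolding W_def using add_sub[OF AX Xp] by simp
  ultimately have "(A, B) \<in> Sig \<longleftrightarrow> noise_ok n P11 P12 P22 W"
    unfolding Sigma_set_def using A B W by auto
  moreover have "residual v (A\<^sup>T *\<^sub>v v) (B\<^sup>T *\<^sub>v v) = v @\<^sub>v W\<^sup>T *\<^sub>v v" if v: "v \<in> carrier_vec n" for v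
  proof -
    have "W\<^sup>T = Xp\<^sup>T - (Xm\<^sup>T * A\<^sup>T + Um\<^sup>T * B\<^sup>T)"
      unfolding W_def using Xp AX A B Xm Um
      by (simp add: transpose_minus[of _ n T] transpose_add[of _ n T] transpose_mult[of _ n n _ T] transpose_mult[of _ n m _ T])
    also have "\<dots> *\<^sub>v v = Xp\<^sup>T *\<^sub>v v - (Xm\<^sup>T * A\<^sup>T + Um\<^sup>T * B\<^sup>T) *\<^sub>v v"
      by (rule minus_mult_distrib_mat_vec[of _ T n]) (use Xp Xm A Um B v in auto)
    also have "(Xm\<^sup>T * A\<^sup>T + Um\<^sup>T * B\<^sup>T) *\<^sub>v v = (Xm\<^sup>T * A\<^sup>T) *\<^sub>v v + (Um\<^sup>T * B\<^sup>T) *\<^sub>v v"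
      by (rule add_mult_distrib_mat_vec[of _ T n]) (use Xm A Um B v in auto)
    also have "(Xm\<^sup>T * A\<^sup>T) *\<^sub>v v = Xm\<^sup>T *\<^sub>v (A\<^sup>T *\<^sub>v v)"
      by (rule assoc_mult_mat_vec[of _ T n _ n]) (use Xm A v in auto)
    also have "(Um\<^sup>T * B\<^sup>T) *\<^sub>v v = Um\<^sup>T *\<^sub>v (B\<^sup>T *\<^sub>v v)"
      by (rule assoc_mult_mat_vec[of _ T m _ n]) (use Um B v in auto)
    finally show ?thesis unfolding residual_def by simp
  qed
  ultimately show ?thesis
    using A B by (simp add: noise_ok_iff[OF W] bf_N)
qed

section \<open>Reduction of the LMI and its sufficiency\<close>

lemma bf_lyapunov:
  assumes P: "P \<in> carrier_mat n n" and K: "K \<in> carrier_mat m n"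
    and A: "A \<in> carrier_mat n n" and B: "B \<in> carrier_mat n m" and v: "v \<in> carrier_vec n"
  shows "bf (P - (A + B * K) * P * (A + B * K)\<^sup>T) v v = bf P v v -
    bf P (A\<^sup>T *\<^sub>v v + K\<^sup>T *\<^sub>v (B\<^sup>T *\<^sub>v v)) (A\<^sup>T *\<^sub>v v + K\<^sup>T *\<^sub>v (B\<^sup>T *\<^sub>v v))"
proof -
  have C: "A + B * K \<in> carrier_mat n n" using A B K by simp
  have "(A + B * K)\<^sup>T = A\<^sup>T + K\<^sup>T * B\<^sup>T"
    using A B K by (simp add: transpose_add[of _ n n] transpose_mult[of _ n m _ n])
  also have "\<dots> *\<^sub>v v = A\<^sup>T *\<^sub>v v + (K\<^sup>T * B\<^sup>T) *\<^sub>v v"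
    by (rule add_mult_distrib_mat_vec[of _ n n]) (use A B K v in auto)
  also have "(K\<^sup>T * B\<^sup>T) *\<^sub>v v = K\<^sup>T *\<^sub>v (B\<^sup>T *\<^sub>v v)"
    by (rule assoc_mult_mat_vec[of _ n m _ n]) (use B K v in auto)
  finally have Cv: "(A + B * K)\<^sup>T *\<^sub>v v = A\<^sup>T *\<^sub>v v + K\<^sup>T *\<^sub>v (B\<^sup>T *\<^sub>v v)" .
  have "(A + B * K) * P * (A + B * K)\<^sup>T \<in> carrier_mat n n" using C P by simp
  from bf_minus[OF P this v] bf_congruence[OF C P v] show ?thesis unfolding Cv by simp
qed

text \<open>A Schur complement argument without an inverse: w enters only through the nonnegative
  \<open>P\<close>-form of w + \<open>K\<^sup>T *\<^sub>v z\<close>, which attains 0 at w = -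
  \<open>K\<^sup>T *\<^sub>v z\<close>.\<close>

lemma LMI_psd_iff:
  assumes P: "pd_mat n P" and K: "K \<in> carrier_mat m n"
  shows "psd_mat (3 * n + m) (LMI_block n m P (K * P) \<beta> - \<alpha> \<cdot>\<^sub>m N4) \<longleftrightarrow>
    (\<forall>x\<in>carrier_vec n. \<forall>y\<in>carrier_vec n. \<forall>z\<in>carrier_vec m.
      \<alpha> * bf N (x @\<^sub>v (y @\<^sub>v z)) (x @\<^sub>v (y @\<^sub>v z)) + \<beta> * (x \<bullet> x) \<le>
      bf P x x - bf P (y + K\<^sup>T *\<^sub>v z) (y + K\<^sup>T *\<^sub>v z))" (is "_ \<longleftrightarrow> ?R")
proof -
  let ?d = "(n + n) + (m + n)"
  let ?M = "LMI_block n m P (K * P) \<beta>"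
  have P': "P \<in> carrier_mat n n" "P\<^sup>T = P" using P by (auto simp: pd_mat_def)
  have KP: "K * P \<in> carrier_mat m n" using K P' by simp
  have M: "?M \<in> carrier_mat ?d ?d" "?M\<^sup>T = ?M"
    using LMI_block_carrier[OF P'(1) KP] LMI_block_sym[OF P' KP] by auto
  have aN: "\<alpha> \<cdot>\<^sub>m N4 \<in> carrier_mat ?d ?d" using N4 by simp
  have form: "bf (?M - \<alpha> \<cdot>\<^sub>m N4) ((x @\<^sub>v y) @\<^sub>v (z @\<^sub>v w)) ((x @\<^sub>v y) @\<^sub>v (z @\<^sub>v w)) =
      bf P x x - \<beta> * (x \<bullet> x) - bf P (y + K\<^sup>T *\<^sub>v z) (y + K\<^sup>T *\<^sub>v z)
      + bf P (w + K\<^sup>T *\<^sub>v z) (w + K\<^sup>T *\<^sub>v z) - \<alpha> * bf N (x @\<^sub>v (y @\<^sub>v z)) (x @\<^sub>v (y @\<^sub>v z))"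
    if v: "x \<in> carrier_vec n" "y \<in> carrier_vec n" "z \<in> carrier_vec m" "w \<in> carrier_vec n" for x y z w
  proof -
    have "(x @\<^sub>v y) @\<^sub>v (z @\<^sub>v w) \<in> carrier_vec ?d" using v by (intro append_carrier_vec)
    then show ?thesis
      by (simp add: bf_minus[OF M(1) aN] bf_smult_mat[OF N4(1)] bf_LMI_block_complete_square[OF P' K v] bf_N4[OF v])
  qed
  have d: "3 * n + m = ?d" by simp
  have "psd_mat (3 * n + m) (?M - \<alpha> \<cdot>\<^sub>m N4) \<longleftrightarrow> (\<forall>v\<in>carrier_vec ?d. 0 \<le> bf (?M - \<alpha> \<cdot>\<^sub>m N4) v v)"
    unfolding psd_mat_bf d using M aN N4
    by (simp add: transpose_minus[of _ ?d ?d] transpose_smult minus_carrier_mat)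
  also have "\<dots> \<longleftrightarrow> ?R"
  proof safe
    fix x y z :: "real vec"
    assume h: "\<forall>v\<in>carrier_vec ?d. 0 \<le> bf (?M - \<alpha> \<cdot>\<^sub>m N4) v v"
      and v: "x \<in> carrier_vec n" "y \<in> carrier_vec n" "z \<in> carrier_vec m"
    have w: "- (K\<^sup>T *\<^sub>v z) \<in> carrier_vec n" using K v by simp
    have "(x @\<^sub>v y) @\<^sub>v (z @\<^sub>v - (K\<^sup>T *\<^sub>v z)) \<in> carrier_vec ?d" using v w by (intro append_carrier_vec)
    moreover have "- (K\<^sup>T *\<^sub>v z) + K\<^sup>T *\<^sub>v z = 0\<^sub>v n" using K v by (auto intro!: eq_vecI)
    moreover have "bf P (0\<^sub>v n) (0\<^sub>v n) = 0" unfolding bf_def using P' by simp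
    ultimately show "\<alpha> * bf N (x @\<^sub>v (y @\<^sub>v z)) (x @\<^sub>v (y @\<^sub>v z)) + \<beta> * (x \<bullet> x) \<le>
      bf P x x - bf P (y + K\<^sup>T *\<^sub>v z) (y + K\<^sup>T *\<^sub>v z)"
      using h form[OF v w] by fastforce
  next
    fix v :: "real vec" assume R: ?R and "v \<in> carrier_vec ?d"
    then obtain x y z w where v: "x \<in> carrier_vec n" "y \<in> carrier_vec n" "z \<in> carrier_vec m" "w \<in> carrier_vec n"
      "v = (x @\<^sub>v y) @\<^sub>v (z @\<^sub>v w)"
      by (metis vec_split)
    have "w + K\<^sup>T *\<^sub>v z \<in> carrier_vec n" using K v by simp
    then show "0 \<le> bf (?M - \<alpha> \<cdot>\<^sub>m N4) v v"
      unfolding v(5) form[OF v(1-4)] using R v(1-3) pd_mat_nonneg[OF P] by fastforce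
  qed
  finally show ?thesis .
qed

text \<open>On the graph of a pair in \<open>Sig\<close> the \<open>N\<close>-term of the reduced
  inequality is nonnegative, and \<beta> |v|^2 makes the Lyapunov inequality strict.\<close>

lemma gain_stabilizes:
  assumes P: "pd_mat n P" and K: "K \<in> carrier_mat m n" and \<alpha>: "\<alpha> \<ge> 0" and \<beta>: "\<beta> > 0"
    and lmi: "psd_mat (3 * n + m) (LMI_block n m P (K * P) \<beta> - \<alpha> \<cdot>\<^sub>m N4)"
    and AB: "(A, B) \<in> Sig"
  shows "pd_mat n (P - (A + B * K) * P * (A + B * K)\<^sup>T)"
proof -
  have A: "A \<in> carrier_mat n n" and B: "B \<in> carrier_mat n m" using AB unfolding Sigma_set_def by auto
  have P': "P \<in> carrier_mat n n" "P\<^sup>T = P" using P by (auto simp: pd_mat_def)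
  have C: "A + B * K \<in> carrier_mat n n" using A B K by simp
  have "0 < bf (P - (A + B * K) * P * (A + B * K)\<^sup>T) v v" if v: "v \<in> carrier_vec n" "v \<noteq> 0\<^sub>v n" for v
  proof -
    let ?x = "v @\<^sub>v (A\<^sup>T *\<^sub>v v @\<^sub>v B\<^sup>T *\<^sub>v v)"
    have "A\<^sup>T *\<^sub>v v \<in> carrier_vec n" "B\<^sup>T *\<^sub>v v \<in> carrier_vec m" using A B v by auto
    then have "\<alpha> * bf N ?x ?x + \<beta> * (v \<bullet> v) \<le> bf (P - (A + B * K) * P * (A + B * K)\<^sup>T) v v"
      using lmi v unfolding LMI_psd_iff[OF P K] bf_lyapunov[OF P'(1) K A B v(1)] by blast
    moreover have "0 \<le> \<alpha> * bf N ?x ?x" using AB \<alpha> v unfolding Sigma_iff[OF A B] by simp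
    moreover have "0 < v \<bullet> v"
      using scalar_prod_self_nonneg[of v] scalar_prod_self_eq_0[OF v(1)] v(2) by force
    ultimately show ?thesis using \<beta> by (smt (verit) mult_pos_pos)
  qed
  then show ?thesis
    unfolding pd_mat_bf using P' congruence_sym[OF C P'] by (auto simp: transpose_minus[of _ n n] minus_carrier_mat)
qed

section \<open>Necessity under the Slater condition\<close>

lemma Slater_bf:
  assumes Zb: "Zb \<in> carrier_mat (n + m) n"
    and pd: "pd_mat n ((1\<^sub>m n @\<^sub>r Zb)\<^sup>T * N * (1\<^sub>m n @\<^sub>r Zb))"
    and v: "v \<in> carrier_vec n" "v \<noteq> 0\<^sub>v n"
  shows "0 < bf N (v @\<^sub>v Zb *\<^sub>v v) (v @\<^sub>v Zb *\<^sub>v v)"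
proof -
  define E where "E = (1\<^sub>m n @\<^sub>r Zb)\<^sup>T"
  have E: "E \<in> carrier_mat n (n + (n + m))"
    unfolding E_def using carrier_append_rows[OF _ Zb, of "1\<^sub>m n" n] by simp
  have Ev: "E\<^sup>T *\<^sub>v v = v @\<^sub>v Zb *\<^sub>v v"
    unfolding E_def using mat_mult_append[OF _ Zb v(1), of "1\<^sub>m n" n] v by simp
  have "0 < bf (E * N * E\<^sup>T) v v" using pd v unfolding pd_mat_bf E_def by simp
  then show ?thesis unfolding bf_congruence[OF E N(1) v(1)] Ev .
qed

lemma LMI_necessary:
  assumes n: "0 < n" and Zb: "Zb \<in> carrier_mat (n + m) n"
    and Slater: "pd_mat n ((1\<^sub>m n @\<^sub>r Zb)\<^sup>T * N * (1\<^sub>m n @\<^sub>r Zb))"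
    and P: "pd_mat n P" and K: "K \<in> carrier_mat m n"
    and stab: "\<And>A B. (A, B) \<in> Sig \<Longrightarrow> pd_mat n (P - (A + B * K) * P * (A + B * K)\<^sup>T)"
  obtains \<alpha> \<beta> where "\<alpha> \<ge> 0" "\<beta> > 0"
    "psd_mat (3 * n + m) (LMI_block n m P (K * P) \<beta> - \<alpha> \<cdot>\<^sub>m N4)"
proof -
  let ?d = "n + (n + m)"
  have P': "P \<in> carrier_mat n n" "P\<^sup>T = P" using P by (auto simp: pd_mat_def)
  \<comment> \<open>With this G the form of \<open>G * P * G\<^sup>T\<close> at (y, z) is the
    \<open>P\<close>-form of y + \<open>K\<^sup>T *\<^sub>v z\<close>, so M below carries the
    right-hand side of \<open>LMI_psd_iff\<close>.\<close>
  define G where "G = 1\<^sub>m n @\<^sub>r K"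
  have G: "G \<in> carrier_mat (n + m) n" unfolding G_def using K by (intro carrier_append_rows) auto
  define H where "H = G * P * G\<^sup>T"
  have H: "H \<in> carrier_mat (n + m) (n + m)" "H\<^sup>T = H" unfolding H_def using congruence_sym[OF G P'] .
  define M where "M = four_block_mat P (0\<^sub>m n (n + m)) (0\<^sub>m (n + m) n) (- H)"
  have M: "M \<in> carrier_mat ?d ?d" "M\<^sup>T = M"
    unfolding M_def using P' H
    by (auto intro!: four_block_carrier_mat simp: transpose_four_block_mat[of _ n n _ "n + m" _ "n + m"] transpose_uminus)
  have Mform: "bf M (x @\<^sub>v (y @\<^sub>v z)) (x @\<^sub>v (y @\<^sub>v z)) = bf P x x - bf P (y + K\<^sup>T *\<^sub>v z) (y + K\<^sup>T *\<^sub>v z)"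
    if v: "x \<in> carrier_vec n" "y \<in> carrier_vec n" "z \<in> carrier_vec m" for x y z
  proof -
    have yz: "y @\<^sub>v z \<in> carrier_vec (n + m)" using v by simp
    have "G\<^sup>T *\<^sub>v (y @\<^sub>v z) = y + K\<^sup>T *\<^sub>v z"
      unfolding G_def using K v by (simp add: transpose_append_rows_mult_vec[of _ n n _ m])
    then have "bf H (y @\<^sub>v z) (y @\<^sub>v z) = bf P (y + K\<^sup>T *\<^sub>v z) (y + K\<^sup>T *\<^sub>v z)"
      unfolding H_def using bf_congruence[OF G P'(1) yz] by simp
    moreover have "M *\<^sub>v (x @\<^sub>v (y @\<^sub>v z)) = P *\<^sub>v x @\<^sub>v - (H *\<^sub>v (y @\<^sub>v z))"
      unfolding M_def using P' H v yz by (subst mult_mat_vec_split[of _ n _ "n + m"]) auto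
    ultimately show ?thesis
      unfolding bf_def using P' H v yz by (simp add: scalar_prod_append[of _ n _ "n + m"])
  qed
  have Mneg: "bf M (0\<^sub>v n @\<^sub>v w) (0\<^sub>v n @\<^sub>v w) \<le> 0" if w: "w \<in> carrier_vec (n + m)" for w
  proof -
    obtain y z where yz: "y \<in> carrier_vec n" "z \<in> carrier_vec m" "w = y @\<^sub>v z" using vec_split[OF w] .
    have "bf P (0\<^sub>v n) (0\<^sub>v n) = 0" unfolding bf_def using P' by simp
    then show ?thesis
      unfolding yz(3) Mform[OF zero_carrier_vec yz(1,2)]
      using pd_mat_nonneg[OF P, of "y + K\<^sup>T *\<^sub>v z"] K yz by simp
  qed
  have imp: "0 < bf M (v @\<^sub>v Z *\<^sub>v v) (v @\<^sub>v Z *\<^sub>v v)"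
    if Z: "Z \<in> carrier_mat (n + m) n"
      and ZN: "\<And>u. u \<in> carrier_vec n \<Longrightarrow> 0 \<le> bf N (u @\<^sub>v Z *\<^sub>v u) (u @\<^sub>v Z *\<^sub>v u)"
      and v: "v \<in> carrier_vec n" "v \<noteq> 0\<^sub>v n" for Z v
  proof -
    \<comment> \<open>Transposing the two row blocks of Z recovers a pair (A, B), so each gain
      considered by the S-lemma comes from a system in \<open>Sig\<close>.\<close>
    define A where "A = mat n n (\<lambda>(i, j). Z $$ (j, i))"
    define B where "B = mat n m (\<lambda>(i, j). Z $$ (n + j, i))"
    have AB: "A \<in> carrier_mat n n" "B \<in> carrier_mat n m" unfolding A_def B_def by auto
    have Zu: "Z *\<^sub>v u = A\<^sup>T *\<^sub>v u @\<^sub>v B\<^sup>T *\<^sub>v u" if "u \<in> carrier_vec n" for u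
      unfolding A_def B_def using Z that by (intro eq_vecI) (auto simp: scalar_prod_def)
    have "(A, B) \<in> Sig" unfolding Sigma_iff[OF AB] using ZN Zu by simp
    then have "0 < bf (P - (A + B * K) * P * (A + B * K)\<^sup>T) v v" using stab v unfolding pd_mat_bf by blast
    then show ?thesis
      unfolding bf_lyapunov[OF P'(1) K AB v(1)] Zu[OF v(1)] using AB v by (simp add: Mform)
  qed
  obtain \<alpha> \<beta> where \<alpha>: "\<alpha> \<ge> 0" and \<beta>: "\<beta> > 0" and
    bound: "\<And>x1 x2. x1 \<in> carrier_vec n \<Longrightarrow> x2 \<in> carrier_vec (n + m) \<Longrightarrow>
      \<alpha> * bf N (x1 @\<^sub>v x2) (x1 @\<^sub>v x2) + \<beta> * (x1 \<bullet> x1) \<le> bf M (x1 @\<^sub>v x2) (x1 @\<^sub>v x2)"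
    using strict_matrix_S_lemma[OF n M N Mneg N_kernel Zb Slater_bf[OF Zb Slater] imp] by blast
  have "psd_mat (3 * n + m) (LMI_block n m P (K * P) \<beta> - \<alpha> \<cdot>\<^sub>m N4)"
    unfolding LMI_psd_iff[OF P K]
  proof (intro ballI)
    fix x y z :: "real vec" assume v: "x \<in> carrier_vec n" "y \<in> carrier_vec n" "z \<in> carrier_vec m"
    then show "\<alpha> * bf N (x @\<^sub>v (y @\<^sub>v z)) (x @\<^sub>v (y @\<^sub>v z)) + \<beta> * (x \<bullet> x) \<le>
      bf P x x - bf P (y + K\<^sup>T *\<^sub>v z) (y + K\<^sup>T *\<^sub>v z)"
      using bound[OF v(1), of "y @\<^sub>v z"] Mform[OF v] by simp
  qed
  then show ?thesis using that \<alpha> \<beta> by blast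
qed

text \<open>Covers the dimension in which there is no nonzero vector for the strict S-lemma: all
  terms of the reduced inequality are zero.\<close>

lemma LMI_dim_0:
  assumes n: "n = 0" and P: "pd_mat n P" and K: "K \<in> carrier_mat m n"
  shows "psd_mat (3 * n + m) (LMI_block n m P (K * P) 1 - 0 \<cdot>\<^sub>m N4)"
  unfolding LMI_psd_iff[OF P K] bf_def using n P K by (auto simp: scalar_prod_def pd_mat_def)

text \<open>Any L has the form K P, so the results stated for \<open>K * P\<close> apply to every
  solution of the LMI.\<close>

lemma gain_from_L:
  assumes P: "pd_mat n P" and L: "L \<in> carrier_mat m n"
  shows "L * the (mat_inverse P) \<in> carrier_mat m n" "(L * the (mat_inverse P)) * P = L"
  using pd_mat_inverse[OF P] L P by (auto simp: pd_mat_def assoc_mult_mat[of _ m n _ n _ n])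

end

theorem theorem7:
  fixes n m T :: nat
    and As Xp Xm Bs Um Wm P11 P12 P22 :: "real mat"
  assumes Xp: "Xp \<in> carrier_mat n T" and Xm: "Xm \<in> carrier_mat n T"
    and Um: "Um \<in> carrier_mat m T"
    and shift: "\<forall>i < n. \<forall>j. Suc j < T \<longrightarrow> Xp $$ (i, j) = Xm $$ (i, Suc j)"
    and As: "As \<in> carrier_mat n n" and Bs: "Bs \<in> carrier_mat n m"
    and Wm: "Wm \<in> carrier_mat n T"
    and sys: "Xp = As * Xm + Bs * Um + Wm"
    and P11: "P11 \<in> carrier_mat n n" and P11_sym: "transpose_mat P11 = P11"
    and P12: "P12 \<in> carrier_mat n T"
    and P22: "P22 \<in> carrier_mat T T" and P22_neg: "pd_mat T (- P22)"
    and noise: "noise_ok n P11 P12 P22 Wm"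
    and Slater: "\<exists>Zb \<in> carrier_mat (n + m) n.
       pd_mat n (transpose_mat (1\<^sub>m n @\<^sub>r Zb) * N_mat n m Xp Xm Um P11 P12 P22 *
                 (1\<^sub>m n @\<^sub>r Zb))"
  shows "(informative_qs n m T Xp Xm Um P11 P12 P22 \<longleftrightarrow>
            (\<exists>P L \<alpha> \<beta>. pd_mat n P \<and> L \<in> carrier_mat m n \<and> \<alpha> \<ge> 0 \<and> \<beta> > 0 \<and>
               psd_mat (3 * n + m) (LMI_block n m P L \<beta> -
                   \<alpha> \<cdot>\<^sub>m N4_mat n m T Xp Xm Um P11 P12 P22)))
       \<and> (\<forall>P L \<alpha> \<beta>. pd_mat n P \<and> L \<in> carrier_mat m n \<and> \<alpha> \<ge> 0 \<and> \<beta> > 0 \<and>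
               psd_mat (3 * n + m) (LMI_block n m P L \<beta> -
                   \<alpha> \<cdot>\<^sub>m N4_mat n m T Xp Xm Um P11 P12 P22) \<longrightarrow>
            (let K = L * the (mat_inverse P) in
              \<forall>(A, B) \<in> Sigma_set n m T Xp Xm Um P11 P12 P22.
                pd_mat n (P - (A + B * K) * P * transpose_mat (A + B * K)) \<and>
                schur_stable (A + B * K)))"
proof -
  interpret noisy_data n m T Xp Xm Um P11 P12 P22
    by unfold_locales (use Xp Xm Um P11 P11_sym P12 P22 P22_neg in auto)
  have sufficient: "pd_mat n (P - (A + B * K) * P * (A + B * K)\<^sup>T) \<and> schur_stable (A + B * K)"
    if P: "pd_mat n P" and L: "L \<in> carrier_mat m n" and \<alpha>: "\<alpha> \<ge> 0" and \<beta>: "\<beta> > 0"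
      and lmi: "psd_mat (3 * n + m) (LMI_block n m P L \<beta> - \<alpha> \<cdot>\<^sub>m N4)"
      and AB: "(A, B) \<in> Sig" and K_def: "K = L * the (mat_inverse P)" for P L \<alpha> \<beta> A B K
  proof -
    have K: "K \<in> carrier_mat m n" "K * P = L" unfolding K_def using gain_from_L[OF P L] .
    have "pd_mat n (P - (A + B * K) * P * (A + B * K)\<^sup>T)"
      using gain_stabilizes[OF P K(1) \<alpha> \<beta> _ AB] lmi unfolding K(2) .
    moreover have "A + B * K \<in> carrier_mat n n"
      using AB K(1) unfolding Sigma_set_def by auto
    ultimately show ?thesis using schur_stable_lyapunov[OF P] by blast
  qed
  have necessary: "\<exists>P L \<alpha> \<beta>. pd_mat n P \<and> L \<in> carrier_mat m n \<and> \<alpha> \<ge> 0 \<and> \<beta> > 0 \<and>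
      psd_mat (3 * n + m) (LMI_block n m P L \<beta> - \<alpha> \<cdot>\<^sub>m N4)"
    if inf: "informative_qs n m T Xp Xm Um P11 P12 P22"
  proof -
    obtain K P where K: "K \<in> carrier_mat m n" and P: "pd_mat n P"
      and stab: "\<And>A B. (A, B) \<in> Sig \<Longrightarrow> pd_mat n (P - (A + B * K) * P * (A + B * K)\<^sup>T)"
      using inf unfolding informative_qs_def by blast
    obtain \<alpha> \<beta> where "\<alpha> \<ge> 0" "\<beta> > 0" "psd_mat (3 * n + m) (LMI_block n m P (K * P) \<beta> - \<alpha> \<cdot>\<^sub>m N4)"
    proof (cases "n = 0")
      case True
      then show ?thesis using that[of 0 1] LMI_dim_0[OF _ P K] by simp
    next
      case False
      then show ?thesis using LMI_necessary[OF _ _ _ P K stab] Slater that by (metis neq0_conv)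
    qed
    moreover have "K * P \<in> carrier_mat m n" using K P by (auto simp: pd_mat_def)
    ultimately show ?thesis using P by blast
  qed
  have informative: "informative_qs n m T Xp Xm Um P11 P12 P22"
    if h: "pd_mat n P" "L \<in> carrier_mat m n" "\<alpha> \<ge> 0" "\<beta> > 0"
      "psd_mat (3 * n + m) (LMI_block n m P L \<beta> - \<alpha> \<cdot>\<^sub>m N4)" for P L \<alpha> \<beta>
    unfolding informative_qs_def
  proof (intro bexI exI conjI ballI)
    show "L * the (mat_inverse P) \<in> carrier_mat m n" by (rule gain_from_L[OF h(1,2)])
    show "pd_mat n P" by (rule h)
    show "case p of (A, B) \<Rightarrow> pd_mat n (P - (A + B * (L * the (mat_inverse P))) * P *
        (A + B * (L * the (mat_inverse P)))\<^sup>T)" if "p \<in> Sig" for p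
      using sufficient[OF h _ refl] that by (cases p) blast
  qed
  show ?thesis
  proof (intro conjI iffI allI impI)
    assume "informative_qs n m T Xp Xm Um P11 P12 P22"
    then show "\<exists>P L \<alpha> \<beta>. pd_mat n P \<and> L \<in> carrier_mat m n \<and> \<alpha> \<ge> 0 \<and> \<beta> > 0 \<and>
        psd_mat (3 * n + m) (LMI_block n m P L \<beta> - \<alpha> \<cdot>\<^sub>m N4)"
      by (rule necessary)
  next
    assume "\<exists>P L \<alpha> \<beta>. pd_mat n P \<and> L \<in> carrier_mat m n \<and> \<alpha> \<ge> 0 \<and> \<beta> > 0 \<and>
        psd_mat (3 * n + m) (LMI_block n m P L \<beta> - \<alpha> \<cdot>\<^sub>m N4)"
    then show "informative_qs n m T Xp Xm Um P11 P12 P22" using informative by blast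
  next
    fix P L \<alpha> \<beta>
    assume h: "pd_mat n P \<and> L \<in> carrier_mat m n \<and> \<alpha> \<ge> 0 \<and> \<beta> > 0 \<and>
        psd_mat (3 * n + m) (LMI_block n m P L \<beta> - \<alpha> \<cdot>\<^sub>m N4)"
    show "let K = L * the (mat_inverse P) in \<forall>(A, B) \<in> Sig.
        pd_mat n (P - (A + B * K) * P * transpose_mat (A + B * K)) \<and> schur_stable (A + B * K)"
      unfolding Let_def
    proof (intro ballI)
      fix p assume p: "p \<in> Sig"
      obtain A B where AB: "p = (A, B)" by (cases p)
      show "case p of (A, B) \<Rightarrow>
          pd_mat n (P - (A + B * (L * the (mat_inverse P))) * P * (A + B * (L * the (mat_inverse P)))\<^sup>T) \<and>
          schur_stable (A + B * (L * the (mat_inverse P)))"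
        using sufficient[of P L \<alpha> \<beta> A B, OF _ _ _ _ _ _ refl] h p unfolding AB by simp
    qed
  qed
qed

end
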